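(* The restriction to the center $$\pi\colon Z(U)\longrightarrow U_q(F,K^{\pm1})$$ of the projection $\pi$ is an algebra isomorphism of $Z(U)$ onto its image $W(F,K^{\pm1})$ in $U_q(F,K^{\pm1})$.
   Context: Let $q\in\mathbb{C}$ be nonzero and not a root of unity, and let $m\geq 1$ be an integer. Put $f_m(K)=\frac{K^{m}-K^{-m}}{q-q^{-1}}$. $U=U_q(f_m(K))$ is the associative unital $\mathbb{C}$-algebra generated by $E,F,K^{\pm1}$ with relations $KE=q^{2}EK$, $KF=q^{-2}FK$, $KK^{-1}=K^{-1}K=1$, $EF-FE=f_m(K)$; $Z(U)$ is its center. $U_q(E)$ is the subalgebra generated by $E$ and $U_q(F,K^{\pm1})$ the subalgebra generated by $F,K^{\pm1}$. Fix a non-singular character $\eta$ of $U_q(E)$, i.e. an algebra homomorphism $\eta\colon U_q(E)\to\mathbb{C}$ with $\eta(E)\neq 0$, and let $U_{q,\eta}(E)=\ker\eta$. One has the vector space decomposition $U=U_q(F,K^{\pm1})\oplus U\,U_{q,\eta}(E)$, and $\pi\colon U\to U_q(F,K^{\pm1})$ denotes the projection onto the first summand. $W(F,K^{\pm1})$ denotes the image $\pi(Z(U))$. *)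

theory Defs
  imports
    Complex_Main
    "HOL-Library.Poly_Mapping"
    "HOL-Algebra.Algebra"
    "HOL-Algebra.Algebraic_Closure_Type"
begin

section \<open>Associative unital algebras over the complex numbers\<close>

abbreviation complex_ring :: "complex ring" where
  "complex_ring \<equiv> ring_of_type_algebra"

text \<open>The library locale \<^locale>\<open>algebra\<close> requires a commutative multiplication; the
  following is its noncommutative analogue.\<close>

locale complex_algebra = module complex_ring A + ring A for A (structure) +
  assumes smult_mult_left: "\<lbrakk>x \<in> carrier A; y \<in> carrier A\<rbrakk> \<Longrightarrow> (c \<odot> x) \<otimes> y = c \<odot> (x \<otimes> y)"
    and smult_mult_right: "\<lbrakk>x \<in> carrier A; y \<in> carrier A\<rbrakk> \<Longrightarrow> x \<otimes> (c \<odot> y) = c \<odot> (x \<otimes> y)"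

definition complex_as_algebra :: "(complex, complex) module" where
  "complex_as_algebra =
     \<lparr>carrier = UNIV, monoid.mult = (*), one = 1, ring.zero = 0, add = (+), module.smult = (*)\<rparr>"

definition subalgebra_of :: "'a set \<Rightarrow> (complex, 'a, 'b) module_scheme \<Rightarrow> bool" where
  "subalgebra_of B A \<longleftrightarrow> subring B A \<and> submodule B complex_ring A"

definition generated_subalgebra :: "(complex, 'a, 'b) module_scheme \<Rightarrow> 'a set \<Rightarrow> 'a set" where
  "generated_subalgebra A S = \<Inter>{B. subalgebra_of B A \<and> S \<subseteq> B}"

definition algebra_hom ::
  "(complex, 'a, 'c) module_scheme \<Rightarrow> (complex, 'b, 'd) module_scheme \<Rightarrow> ('a \<Rightarrow> 'b) set" where
  "algebra_hom A B =
     {h \<in> ring_hom A B. \<forall>c. \<forall>x \<in> carrier A. h (c \<odot>\<^bsub>A\<^esub> x) = c \<odot>\<^bsub>B\<^esub> h x}"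

definition algebra_iso ::
  "(complex, 'a, 'c) module_scheme \<Rightarrow> (complex, 'b, 'd) module_scheme \<Rightarrow> ('a \<Rightarrow> 'b) set" where
  "algebra_iso A B =
     {h \<in> algebra_hom A B. complex_algebra A \<and> complex_algebra B \<and>
        bij_betw h (carrier A) (carrier B)}"

definition algebra_center :: "(complex, 'a, 'b) module_scheme \<Rightarrow> 'a set" where
  "algebra_center A = {z \<in> carrier A. \<forall>u \<in> carrier A. z \<otimes>\<^bsub>A\<^esub> u = u \<otimes>\<^bsub>A\<^esub> z}"

definition quotient_algebra ::
  "(complex, 'a, 'b) module_scheme \<Rightarrow> 'a set \<Rightarrow> (complex, 'a set) module" where
  "quotient_algebra A I =
     ring.extend (A Quot I) \<lparr>module.smult = (\<lambda>c Y. \<Union>x\<in>Y. I +>\<^bsub>A\<^esub> (c \<odot>\<^bsub>A\<^esub> x))\<rparr>"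


section \<open>The free algebra on $E, F, K, K^{-1}$\<close>

datatype generator = GenE | GenF | GenK | GenKinv

text \<open>Words form the free monoid on the generators. It is written additively, because the
  multiplication of \<^typ>\<open>'a \<Rightarrow>\<^sub>0 'b\<close> is the convolution along an additive monoid; the finitely
  supported functions on words are thus the free algebra.\<close>

datatype word = Word "generator list"

instantiation word :: monoid_add
begin

definition "0 = Word []"

fun plus_word :: "word \<Rightarrow> word \<Rightarrow> word" where
  "Word v + Word w = Word (v @ w)"

instance
proof
  fix a b c :: word
  show "a + b + c = a + (b + c)" by (cases a; cases b; cases c) simp
  show "0 + a = a" "a + 0 = a" by (cases a; simp add: zero_word_def)+
qed

end

type_synonym free_alg = "word \<Rightarrow>\<^sub>0 complex"

abbreviation gen :: "generator \<Rightarrow> free_alg" where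
  "gen g \<equiv> Poly_Mapping.single (Word [g]) 1"

abbreviation scalar :: "complex \<Rightarrow> free_alg" where
  "scalar c \<equiv> Poly_Mapping.single 0 c"

definition free_algebra :: "(complex, free_alg) module" where
  "free_algebra =
     \<lparr>carrier = UNIV, monoid.mult = (*), one = 1, ring.zero = 0, add = (+),
      module.smult = (\<lambda>c x. scalar c * x)\<rparr>"


section \<open>The algebra $U_q(f_m(K))$\<close>

definition f_poly :: "complex \<Rightarrow> nat \<Rightarrow> free_alg" where
  "f_poly q m = scalar (1 / (q - inverse q)) * (gen GenK ^ m - gen GenKinv ^ m)"

definition relators :: "complex \<Rightarrow> nat \<Rightarrow> free_alg set" where
  "relators q m =
     {gen GenK * gen GenE - scalar (q\<^sup>2) * (gen GenE * gen GenK),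
      gen GenK * gen GenF - scalar (inverse (q\<^sup>2)) * (gen GenF * gen GenK),
      gen GenK * gen GenKinv - 1,
      gen GenKinv * gen GenK - 1,
      gen GenE * gen GenF - gen GenF * gen GenE - f_poly q m}"

definition U_ideal :: "complex \<Rightarrow> nat \<Rightarrow> free_alg set" where
  "U_ideal q m = Idl\<^bsub>free_algebra\<^esub> (relators q m)"

definition Uq :: "complex \<Rightarrow> nat \<Rightarrow> (complex, free_alg set) module" where
  "Uq q m = quotient_algebra free_algebra (U_ideal q m)"

definition U_gen :: "complex \<Rightarrow> nat \<Rightarrow> generator \<Rightarrow> free_alg set" where
  "U_gen q m g = U_ideal q m +>\<^bsub>free_algebra\<^esub> gen g"

definition Uq_E :: "complex \<Rightarrow> nat \<Rightarrow> (complex, free_alg set) module" where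
  "Uq_E q m = (Uq q m)\<lparr>carrier := generated_subalgebra (Uq q m) {U_gen q m GenE}\<rparr>"

definition Uq_FK :: "complex \<Rightarrow> nat \<Rightarrow> (complex, free_alg set) module" where
  "Uq_FK q m =
     (Uq q m)\<lparr>carrier := generated_subalgebra (Uq q m) (U_gen q m ` {GenF, GenK, GenKinv})\<rparr>"


section \<open>The Whittaker projection\<close>

definition nonsingular_character ::
  "complex \<Rightarrow> nat \<Rightarrow> (free_alg set \<Rightarrow> complex) \<Rightarrow> bool" where
  "nonsingular_character q m \<eta> \<longleftrightarrow>
     \<eta> \<in> algebra_hom (Uq_E q m) complex_as_algebra \<and> \<eta> (U_gen q m GenE) \<noteq> 0"

definition Uq_eta_E :: "complex \<Rightarrow> nat \<Rightarrow> (free_alg set \<Rightarrow> complex) \<Rightarrow> free_alg set set" where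
  "Uq_eta_E q m \<eta> = a_kernel (Uq_E q m) complex_as_algebra \<eta>"

text \<open>\<^const>\<open>ideal_prod\<close> is the set of finite sums of products and makes sense for arbitrary
  subsets; here it yields the left ideal $U\,U_{q,\eta}(E)$.\<close>

definition U_left_ideal :: "complex \<Rightarrow> nat \<Rightarrow> (free_alg set \<Rightarrow> complex) \<Rightarrow> free_alg set set" where
  "U_left_ideal q m \<eta> = ideal_prod (Uq q m) (carrier (Uq q m)) (Uq_eta_E q m \<eta>)"

text \<open>The first component of \<open>u\<close> in $U = U_q(F,K^{\pm1}) \oplus U\,U_{q,\eta}(E)$. The description
  is well defined only because of this decomposition, which is not built into the definition.\<close>

definition whittaker_proj ::
  "complex \<Rightarrow> nat \<Rightarrow> (free_alg set \<Rightarrow> complex) \<Rightarrow> free_alg set \<Rightarrow> free_alg set" where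
  "whittaker_proj q m \<eta> u =
     (THE a. a \<in> carrier (Uq_FK q m) \<and> (\<exists>b \<in> U_left_ideal q m \<eta>. u = a \<oplus>\<^bsub>Uq q m\<^esub> b))"

definition ZU :: "complex \<Rightarrow> nat \<Rightarrow> (complex, free_alg set) module" where
  "ZU q m = (Uq q m)\<lparr>carrier := algebra_center (Uq q m)\<rparr>"

definition W_FK ::
  "complex \<Rightarrow> nat \<Rightarrow> (free_alg set \<Rightarrow> complex) \<Rightarrow> (complex, free_alg set) module" where
  "W_FK q m \<eta> = (Uq_FK q m)\<lparr>carrier := whittaker_proj q m \<eta> ` carrier (ZU q m)\<rparr>"

end

theory Submission
  imports Defs
begin

text \<open>Write \<open>A\<close> for the subalgebra generated by \<open>F, K, K\<inverse>\<close> and \<open>L\<close> for the left ideal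
  \<open>U ker \<eta>\<close>, so that \<open>U = A \<oplus> L\<close> and \<open>\<pi>\<close> is the projection onto \<open>A\<close>.

  That \<open>\<pi>\<close> is multiplicative on the center is formal. Let \<open>x, y\<close> be central, \<open>a = \<pi> x\<close> and
  \<open>b = \<pi> y\<close>. Then \<open>x y = y x\<close> is congruent to \<open>y a = a y\<close> modulo \<open>L\<close>, because \<open>x - a \<in> L\<close>, and
  \<open>a y\<close> is congruent to \<open>a b\<close>; as \<open>a b \<in> A\<close>, it is \<open>\<pi> (x y)\<close> (\<open>proj_mult_central\<close>).

  Everything else rests on one module, the universal Whittaker module: the vector space with basis
  \<open>F^i K^j w\<close> for \<open>i \<in> \<nat>\<close>, \<open>j \<in> \<int>\<close>, on whose generator \<open>w\<close> the element \<open>E\<close> acts as the scalar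
  \<open>c = \<eta> E\<close>. Left multiplication by the generators shows that the monomials \<open>F^i K^j E^l\<close> span
  \<open>U\<close>, and those with \<open>l = 0\<close> span \<open>A\<close>. As \<open>E^l - c^l \<in> ker \<eta>\<close>, it follows that \<open>A + L = U\<close>. Conversely \<open>L\<close> kills \<open>w\<close>,
  while an element of \<open>A\<close> that kills \<open>w\<close> is zero, since the vectors \<open>F^i K^j w\<close> are independent
  (\<open>FK_faithful\<close>); so \<open>A \<inter> L = 0\<close>.

  For injectivity, let \<open>z\<close> be central with \<open>\<pi> z = 0\<close>. Then \<open>z \<in> L\<close> kills \<open>w\<close>, hence it kills
  \<open>K^n w\<close> for every integer \<open>n\<close>. If \<open>z = \<Sum> r\<^bsub>i,j,l\<^esub> F^i K^j E^l\<close>, the coefficient of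
  \<open>F^i K^(j+n) w\<close> in \<open>z K^n w\<close> is \<open>\<Sum>\<^sub>l r\<^bsub>i,j,l\<^esub> (c q^(-2n))^l\<close>, because \<open>E\<close> acts on \<open>K^n w\<close> as
  \<open>c q^(-2n)\<close>. This is a polynomial in \<open>c q^(-2n)\<close>, and these values are pairwise distinct because
  \<open>c \<noteq> 0\<close> and \<open>q\<close> is not a root of unity. The polynomial has infinitely many roots, so all
  \<open>r\<^bsub>i,j,l\<^esub>\<close> vanish (\<open>whittaker_faithful\<close>).

  The computations take place in the free algebra, modulo the defining ideal.\<close>

section \<open>Modules over the free algebra\<close>

lemma free_alg_induct [case_names zero single add]:
  fixes x :: free_alg
  assumes "P 0" and "\<And>w c. P (Poly_Mapping.single w c)" and "\<And>x y. P x \<Longrightarrow> P y \<Longrightarrow> P (x + y)"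
  shows "P x"
proof (induction x rule: update_induct)
  case const
  then show ?case by (rule assms)
next
  case (update f a b)
  have "Poly_Mapping.update a b f = f + Poly_Mapping.single a b"
    using update by (intro poly_mapping_eqI)
      (auto simp: lookup_update lookup_add lookup_single when_def in_keys_iff)
  then show ?case using assms update by auto
qed

type_synonym 'p vec = "'p \<Rightarrow> complex"

text \<open>A family of operators, one for each generator, turns a function space into a module over the free
  algebra. Vectors are arbitrary functions on the index set, with no condition on their support:
  operators can then be given by formulas for the coefficients of the image, and two of them are
  compared pointwise.\<close>

fun word_act :: "(generator \<Rightarrow> 'p vec \<Rightarrow> 'p vec) \<Rightarrow> word \<Rightarrow> 'p vec \<Rightarrow> 'p vec" where
  "word_act T (Word gs) = foldr T gs"

definition free_act :: "(generator \<Rightarrow> 'p vec \<Rightarrow> 'p vec) \<Rightarrow> free_alg \<Rightarrow> 'p vec \<Rightarrow> 'p vec" where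
  "free_act T x v = (\<lambda>p. \<Sum>w\<in>Poly_Mapping.keys x. Poly_Mapping.lookup x w * word_act T w v p)"

lemma word_act_plus: "word_act T (v + w) u = word_act T v (word_act T w u)"
  by (cases v; cases w) simp

lemma free_act_superset:
  assumes "finite S" "Poly_Mapping.keys x \<subseteq> S"
  shows "free_act T x v p = (\<Sum>w\<in>S. Poly_Mapping.lookup x w * word_act T w v p)"
  unfolding free_act_def using assms
  by (intro sum.mono_neutral_left) (auto simp: in_keys_iff)

lemma free_act_zero [simp]: "free_act T 0 v = (\<lambda>p. 0)"
  by (simp add: free_act_def)

lemma free_act_single: "free_act T (Poly_Mapping.single w c) v = (\<lambda>p. c * word_act T w v p)"
  by (simp add: free_act_def)

lemma free_act_add: "free_act T (x + y) v = (\<lambda>p. free_act T x v p + free_act T y v p)"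
proof
  fix p
  let ?S = "Poly_Mapping.keys x \<union> Poly_Mapping.keys y"
  have "Poly_Mapping.keys (x + y) \<subseteq> ?S" by (rule keys_add)
  then show "free_act T (x + y) v p = free_act T x v p + free_act T y v p"
    by (simp add: free_act_superset[of ?S] lookup_add distrib_right sum.distrib)
qed

lemma free_act_uminus: "free_act T (- x) v = (\<lambda>p. - free_act T x v p)"
  by (rule ext) (simp add: free_act_def sum_negf)

lemma free_act_diff: "free_act T (x - y) v = (\<lambda>p. free_act T x v p - free_act T y v p)"
  using free_act_add[of T x "- y" v] by (simp add: free_act_uminus)

lemma free_act_gen [simp]: "free_act T (gen g) = T g"
  by (rule ext) (simp add: free_act_single)

lemma free_act_scalar: "free_act T (scalar c) v = (\<lambda>p. c * v p)"
  by (simp add: free_act_single zero_word_def)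

lemma free_act_one [simp]: "free_act T 1 v = v"
  using free_act_scalar[of T 1 v] by simp

locale free_module =
  fixes T :: "generator \<Rightarrow> 'p vec \<Rightarrow> 'p vec"
  assumes T_linear: "T g (\<lambda>p. a * u p + b * v p) = (\<lambda>p. a * T g u p + b * T g v p)"
begin

lemma word_act_linear:
  "word_act T w (\<lambda>p. a * u p + b * v p) = (\<lambda>p. a * word_act T w u p + b * word_act T w v p)"
proof (cases w)
  case (Word gs)
  have "foldr T gs (\<lambda>p. a * u p + b * v p) = (\<lambda>p. a * foldr T gs u p + b * foldr T gs v p)"
    by (induction gs) (auto simp: T_linear)
  then show ?thesis using Word by simp
qed

lemma free_act_linear:
  "free_act T x (\<lambda>p. a * u p + b * v p) = (\<lambda>p. a * free_act T x u p + b * free_act T x v p)"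
  by (rule ext) (simp add: free_act_def word_act_linear sum_distrib_left sum.distrib algebra_simps)

lemma free_act_vec_add: "free_act T x (\<lambda>p. u p + v p) = (\<lambda>p. free_act T x u p + free_act T x v p)"
  using free_act_linear[of x 1 u 1 v] by simp

lemma free_act_vec_scale: "free_act T x (\<lambda>p. c * u p) = (\<lambda>p. c * free_act T x u p)"
  using free_act_linear[of x c u 0 u] by simp

lemma free_act_vec_zero: "free_act T x (\<lambda>p. 0) = (\<lambda>p. 0)"
  using free_act_linear[of x 0 u 0 u] by simp

lemma free_act_mult: "free_act T (x * y) v = free_act T x (free_act T y v)"
proof (induction x rule: free_alg_induct)
  case zero
  then show ?case by simp
next
  case (single w c)
  show ?case
  proof (induction y rule: free_alg_induct)
    case zero
    then show ?case by (simp add: free_act_vec_zero)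
  next
    case (single w' c')
    have "word_act T w (\<lambda>p. c' * word_act T w' v p) = (\<lambda>p. c' * word_act T w (word_act T w' v) p)"
      using word_act_linear[of w c' "word_act T w' v" 0 "word_act T w' v"] by simp
    then show ?case
      by (simp add: mult_single free_act_single word_act_plus mult.assoc)
  next
    case (add y z)
    then show ?case by (simp add: free_act_add free_act_vec_add distrib_left)
  qed
next
  case (add x y)
  then show ?case by (simp add: free_act_add distrib_right)
qed

end

section \<open>The defining ideal and the quotient algebra\<close>

lemma scalar_comm: "x * scalar c = scalar c * (x::free_alg)"
  by (induction x rule: free_alg_induct) (simp_all add: mult_single algebra_simps)

lemma scalar_mult: "scalar a * scalar b = scalar (a * b)"
  by (simp add: mult_single)

lemma scalar_add: "scalar (a + b) = scalar a + scalar b"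
  by (simp add: single_add)

lemma scalar_left: "scalar a * (scalar b * x) = scalar (a * b) * (x::free_alg)"
  by (simp add: scalar_mult flip: mult.assoc)

lemma scalar_move: "x * (scalar c * y) = scalar c * (x * (y::free_alg))"
  by (metis mult.assoc scalar_comm)

lemma free_algebra_simps:
  "carrier free_algebra = UNIV" "monoid.mult free_algebra = (*)" "one free_algebra = 1"
  "ring.zero free_algebra = 0" "add free_algebra = (+)"
  "module.smult free_algebra = (\<lambda>c x. scalar c * x)"
  by (simp_all add: free_algebra_def)

interpretation fa: vector_space "\<lambda>c (x::free_alg). scalar c * x"
  by unfold_locales (simp_all add: distrib_left scalar_add distrib_right scalar_mult flip: mult.assoc)

lemma ring_free_algebra: "ring free_algebra"
proof (rule ringI)
  show "abelian_group free_algebra"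
    by (rule abelian_groupI) (auto simp: free_algebra_simps algebra_simps intro: exI[of _ "- x" for x])
  show "Group.monoid free_algebra"
    by (rule Group.monoidI) (auto simp: free_algebra_simps algebra_simps)
qed (auto simp: free_algebra_simps algebra_simps)

lemma a_inv_free_algebra: "a_inv free_algebra x = - x"
  by (rule abelian_group.minus_equality[OF ring.is_abelian_group[OF ring_free_algebra]])
     (simp_all add: free_algebra_simps)

lemma ideal_free_algebraI:
  assumes "0 \<in> J" "\<And>x y. x \<in> J \<Longrightarrow> y \<in> J \<Longrightarrow> x + y \<in> J"
    "\<And>x y. x \<in> J \<Longrightarrow> y * x \<in> J" "\<And>x y. x \<in> J \<Longrightarrow> x * y \<in> J"
  shows "ideal J free_algebra"
proof (rule idealI[OF ring_free_algebra])
  interpret ring free_algebra by (rule ring_free_algebra)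
  have "- x \<in> J" if "x \<in> J" for x
    using assms(3)[OF that, of "- 1"] by simp
  then show "subgroup J (add_monoid free_algebra)"
    using assms by (intro add.subgroupI) (auto simp: free_algebra_simps a_inv_free_algebra simp flip: a_inv_def)
qed (use assms in \<open>auto simp: free_algebra_simps\<close>)

lemma ideal_U_ideal: "ideal (U_ideal q m) free_algebra"
  unfolding U_ideal_def by (rule ring.genideal_ideal[OF ring_free_algebra]) (simp add: free_algebra_simps)

lemma relators_subset: "relators q m \<subseteq> U_ideal q m"
  unfolding U_ideal_def by (rule ring.genideal_self[OF ring_free_algebra]) (simp add: free_algebra_simps)

lemma U_ideal_minimal: "ideal J free_algebra \<Longrightarrow> relators q m \<subseteq> J \<Longrightarrow> U_ideal q m \<subseteq> J"
  unfolding U_ideal_def by (rule ring.genideal_minimal[OF ring_free_algebra])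

lemma U_ideal_add: "x \<in> U_ideal q m \<Longrightarrow> y \<in> U_ideal q m \<Longrightarrow> x + y \<in> U_ideal q m"
  using additive_subgroup.a_closed[OF ideal.axioms(1)[OF ideal_U_ideal]] by (simp add: free_algebra_simps)

lemma U_ideal_zero: "0 \<in> U_ideal q m"
  using additive_subgroup.zero_closed[OF ideal.axioms(1)[OF ideal_U_ideal]] by (simp add: free_algebra_simps)

lemma U_ideal_mult_left: "x \<in> U_ideal q m \<Longrightarrow> y * x \<in> U_ideal q m"
  using ideal.I_l_closed[OF ideal_U_ideal] by (simp add: free_algebra_simps)

lemma U_ideal_mult_right: "x \<in> U_ideal q m \<Longrightarrow> x * y \<in> U_ideal q m"
  using ideal.I_r_closed[OF ideal_U_ideal] by (simp add: free_algebra_simps)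

lemma U_ideal_uminus: "x \<in> U_ideal q m \<Longrightarrow> - x \<in> U_ideal q m"
  using U_ideal_mult_left[of x q m "- 1"] by simp

lemma U_ideal_diff: "x \<in> U_ideal q m \<Longrightarrow> y \<in> U_ideal q m \<Longrightarrow> x - y \<in> U_ideal q m"
  using U_ideal_add[of x q m "- y"] U_ideal_uminus by simp

text \<open>The class of an element in \<open>U\<close>. Every operation of \<open>U\<close> is computed on such representatives by
  \<open>Uq_simps\<close> below, and equality of classes is membership of a difference in the ideal.\<close>

definition cl :: "complex \<Rightarrow> nat \<Rightarrow> free_alg \<Rightarrow> free_alg set" where
  "cl q m x = U_ideal q m +>\<^bsub>free_algebra\<^esub> x"

lemma cl_eq_iff: "cl q m x = cl q m y \<longleftrightarrow> x - y \<in> U_ideal q m"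
proof -
  have mem: "z \<in> cl q m x \<longleftrightarrow> z - x \<in> U_ideal q m" for z x
    unfolding cl_def a_r_coset_def' by (auto simp: free_algebra_simps intro: bexI[of _ "z - x"])
  show ?thesis
  proof
    assume "cl q m x = cl q m y"
    moreover have "x \<in> cl q m x" by (simp add: mem U_ideal_zero)
    ultimately show "x - y \<in> U_ideal q m" using mem by blast
  next
    assume a: "x - y \<in> U_ideal q m"
    show "cl q m x = cl q m y"
    proof (rule Set.set_eqI)
      fix z
      have "z - y = (z - x) + (x - y)" "z - x = (z - y) - (x - y)" by simp_all
      then show "z \<in> cl q m x \<longleftrightarrow> z \<in> cl q m y"
        unfolding mem using a U_ideal_add U_ideal_diff by metis
    qed
  qed
qed

lemma Uq_record:
  "carrier (Uq q m) = a_rcosets\<^bsub>free_algebra\<^esub> (U_ideal q m)"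
  "monoid.mult (Uq q m) = rcoset_mult free_algebra (U_ideal q m)"
  "add (Uq q m) = set_add free_algebra"
  "\<one>\<^bsub>Uq q m\<^esub> = U_ideal q m +>\<^bsub>free_algebra\<^esub> \<one>\<^bsub>free_algebra\<^esub>"
  "\<zero>\<^bsub>Uq q m\<^esub> = U_ideal q m"
  "module.smult (Uq q m) = (\<lambda>c Y. \<Union>x\<in>Y. U_ideal q m +>\<^bsub>free_algebra\<^esub> (c \<odot>\<^bsub>free_algebra\<^esub> x))"
  by (simp_all add: Uq_def quotient_algebra_def ring.defs FactRing_def)

lemma Uq_simps:
  "carrier (Uq q m) = range (cl q m)"
  "cl q m x \<otimes>\<^bsub>Uq q m\<^esub> cl q m y = cl q m (x * y)"
  "cl q m x \<oplus>\<^bsub>Uq q m\<^esub> cl q m y = cl q m (x + y)"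
  "\<one>\<^bsub>Uq q m\<^esub> = cl q m 1"
  "\<zero>\<^bsub>Uq q m\<^esub> = cl q m 0"
  "c \<odot>\<^bsub>Uq q m\<^esub> cl q m x = cl q m (scalar c * x)"
proof -
  interpret I: ideal "U_ideal q m" free_algebra by (rule ideal_U_ideal)
  show "carrier (Uq q m) = range (cl q m)"
    unfolding Uq_record A_RCOSETS_def' cl_def free_algebra_simps by blast
  show "cl q m x \<otimes>\<^bsub>Uq q m\<^esub> cl q m y = cl q m (x * y)"
    unfolding Uq_record cl_def using I.rcoset_mult_add[of x y] by (simp add: free_algebra_simps)
  show "cl q m x \<oplus>\<^bsub>Uq q m\<^esub> cl q m y = cl q m (x + y)"
    unfolding Uq_record cl_def using I.a_rcos_sum[of x y] by (simp add: free_algebra_simps)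
  show "\<one>\<^bsub>Uq q m\<^esub> = cl q m 1"
    unfolding Uq_record cl_def free_algebra_simps ..
  show "\<zero>\<^bsub>Uq q m\<^esub> = cl q m 0"
    by (auto simp: Uq_record cl_def a_r_coset_def' free_algebra_simps)
  have "cl q m (scalar c * y) = cl q m (scalar c * x)" if "y \<in> cl q m x" for y
  proof -
    have "y - x \<in> U_ideal q m"
      using that unfolding cl_def a_r_coset_def' by (auto simp: free_algebra_simps)
    from U_ideal_mult_left[OF this, of "scalar c"] show ?thesis
      by (simp add: cl_eq_iff right_diff_distrib)
  qed
  moreover have "x \<in> cl q m x"
    unfolding cl_def a_r_coset_def' by (auto simp: free_algebra_simps U_ideal_zero intro: bexI[of _ 0])
  moreover have "c \<odot>\<^bsub>Uq q m\<^esub> cl q m x = (\<Union>y\<in>cl q m x. cl q m (scalar c * y))"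
    unfolding Uq_record cl_def free_algebra_simps ..
  ultimately show "c \<odot>\<^bsub>Uq q m\<^esub> cl q m x = cl q m (scalar c * x)"
    by blast
qed

lemma cring_complex: "cring complex_ring" by (rule cring_from_type_algebra)

lemma complex_ring_simps: "carrier complex_ring = UNIV" "a \<otimes>\<^bsub>complex_ring\<^esub> b = a * b"
   "a \<oplus>\<^bsub>complex_ring\<^esub> b = a + b" "\<one>\<^bsub>complex_ring\<^esub> = 1" "\<zero>\<^bsub>complex_ring\<^esub> = 0"
  by (simp_all add: ring_of_type_algebra_def)

lemma complex_algebra_Uq: "complex_algebra (Uq q m)"
proof -
  interpret I: ideal "U_ideal q m" free_algebra by (rule ideal_U_ideal)
  have ag: "abelian_group (Uq q m)"
  proof (rule abelian_groupI)
    fix x assume "x \<in> carrier (Uq q m)"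
    then obtain a where "x = cl q m a" by (auto simp: Uq_simps)
    then show "\<exists>y\<in>carrier (Uq q m). y \<oplus>\<^bsub>Uq q m\<^esub> x = \<zero>\<^bsub>Uq q m\<^esub>"
      by (intro bexI[of _ "cl q m (- a)"]) (auto simp: Uq_simps)
  qed (auto simp: Uq_simps algebra_simps)
  have r: "ring (Uq q m)"
  proof (rule ringI)
    show "Group.monoid (Uq q m)"
      by (rule Group.monoidI) (auto simp: Uq_simps algebra_simps)
  qed (use ag in \<open>auto simp: Uq_simps algebra_simps\<close>)
  have md: "module complex_ring (Uq q m)"
    by (rule moduleI[OF cring_complex ag])
       (auto simp: Uq_simps complex_ring_simps algebra_simps scalar_add scalar_left)
  show ?thesis
    by (intro complex_algebra.intro complex_algebra_axioms.intro r md)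
       (auto simp: Uq_simps mult.assoc scalar_move)
qed

section \<open>Subalgebras\<close>

context complex_algebra
begin

lemma a_inv_eq_smult: "x \<in> carrier A \<Longrightarrow> \<ominus> x = (- 1) \<odot> x"
proof -
  assume x: "x \<in> carrier A"
  have "\<ominus>\<^bsub>complex_ring\<^esub> 1 = - 1"
    by (rule abelian_group.minus_equality)
       (use cring_complex in \<open>auto simp: complex_ring_simps cring_def ring_def\<close>)
  then show ?thesis
    using smult_l_minus[of 1 x] smult_one[OF x] x by (simp add: complex_ring_simps)
qed

lemma subalgebraI:
  assumes "B \<subseteq> carrier A" "\<one> \<in> B"
    and "\<And>x y. x \<in> B \<Longrightarrow> y \<in> B \<Longrightarrow> x \<oplus> y \<in> B"
    and "\<And>x y. x \<in> B \<Longrightarrow> y \<in> B \<Longrightarrow> x \<otimes> y \<in> B"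
    and "\<And>c x. x \<in> B \<Longrightarrow> c \<odot> x \<in> B"
  shows "subalgebra_of B A"
proof -
  have inv: "\<ominus> x \<in> B" if "x \<in> B" for x
    using assms(1) assms(5)[OF that, of "- 1"] that by (auto simp: a_inv_eq_smult)
  have r: "subring B A"
    by (rule subringI) (use assms inv in auto)
  moreover have "submodule B complex_ring A"
    by (rule submoduleI) (use assms inv subringE(2)[OF r] in auto)
  ultimately show ?thesis by (simp add: subalgebra_of_def)
qed

lemma subalgebraE:
  assumes "subalgebra_of B A"
  shows "B \<subseteq> carrier A" "\<one> \<in> B"
    and "\<And>x y. x \<in> B \<Longrightarrow> y \<in> B \<Longrightarrow> x \<oplus> y \<in> B"
    and "\<And>x y. x \<in> B \<Longrightarrow> y \<in> B \<Longrightarrow> x \<otimes> y \<in> B"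
    and "\<And>c x. x \<in> B \<Longrightarrow> c \<odot> x \<in> B"
  using assms submodule.smult_closed[of B complex_ring A]
  by (auto simp: subalgebra_of_def complex_ring_simps dest: subringE)

lemma complex_algebra_subalgebra:
  assumes "subalgebra_of B A"
  shows "complex_algebra (A\<lparr>carrier := B\<rparr>)"
proof -
  note B = subalgebraE[OF assms]
  have "module complex_ring (A\<lparr>carrier := B\<rparr>)"
    using assms module_axioms unfolding subalgebra_of_def
    by (blast intro: submodule.submodule_is_module)
  moreover have "ring (A\<lparr>carrier := B\<rparr>)"
    using assms unfolding subalgebra_of_def by (blast intro: subring_is_ring)
  ultimately show ?thesis
    using subsetD[OF B(1)] by (auto intro!: complex_algebra.intro complex_algebra_axioms.intro
        simp: smult_mult_left smult_mult_right)
qed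

lemma subalgebra_of_subalgebra:
  assumes "subalgebra_of B A" "subalgebra_of C A" "C \<subseteq> B"
  shows "subalgebra_of C (A\<lparr>carrier := B\<rparr>)"
  using subalgebraE[OF assms(2)] assms(3)
  by (intro complex_algebra.subalgebraI complex_algebra_subalgebra assms(1)) auto

lemma subalgebra_carrier: "subalgebra_of (carrier A) A"
  by (rule subalgebraI) (auto simp: complex_ring_simps)

lemma subalgebra_generated:
  assumes "S \<subseteq> carrier A"
  shows "subalgebra_of (generated_subalgebra A S) A"
proof (rule subalgebraI)
  show "generated_subalgebra A S \<subseteq> carrier A"
    unfolding generated_subalgebra_def using subalgebra_carrier assms by blast
qed (auto simp: generated_subalgebra_def dest: subalgebraE)

lemma generated_incl: "S \<subseteq> generated_subalgebra A S"
  by (auto simp: generated_subalgebra_def)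

lemma generated_minimal: "subalgebra_of B A \<Longrightarrow> S \<subseteq> B \<Longrightarrow> generated_subalgebra A S \<subseteq> B"
  by (auto simp: generated_subalgebra_def)

lemma subalgebra_center: "subalgebra_of (algebra_center A) A"
proof -
  have Z: "x \<in> carrier A" "\<And>u. u \<in> carrier A \<Longrightarrow> x \<otimes> u = u \<otimes> x" if "x \<in> algebra_center A" for x
    using that by (simp_all add: algebra_center_def)
  have ZI: "x \<in> algebra_center A"
    if "x \<in> carrier A" "\<And>u. u \<in> carrier A \<Longrightarrow> x \<otimes> u = u \<otimes> x" for x
    using that by (simp add: algebra_center_def)
  show ?thesis
  proof (rule subalgebraI)
    show "algebra_center A \<subseteq> carrier A" using Z by blast
    show "\<one> \<in> algebra_center A" by (rule ZI) simp_all
  next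
    fix x y assume x: "x \<in> algebra_center A" and y: "y \<in> algebra_center A"
    show "x \<oplus> y \<in> algebra_center A"
    proof (rule ZI)
      fix u assume u: "u \<in> carrier A"
      have "(x \<oplus> y) \<otimes> u = x \<otimes> u \<oplus> y \<otimes> u" by (rule l_distr[OF Z(1)[OF x] Z(1)[OF y] u])
      also have "\<dots> = u \<otimes> x \<oplus> u \<otimes> y" by (simp only: Z(2)[OF x u] Z(2)[OF y u])
      also have "\<dots> = u \<otimes> (x \<oplus> y)" by (rule r_distr[OF Z(1)[OF x] Z(1)[OF y] u, symmetric])
      finally show "(x \<oplus> y) \<otimes> u = u \<otimes> (x \<oplus> y)" .
    qed (simp add: Z(1) x y)
    show "x \<otimes> y \<in> algebra_center A"
    proof (rule ZI)
      fix u assume u: "u \<in> carrier A"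
      have "(x \<otimes> y) \<otimes> u = x \<otimes> (y \<otimes> u)" by (rule m_assoc[OF Z(1)[OF x] Z(1)[OF y] u])
      also have "\<dots> = x \<otimes> (u \<otimes> y)" by (simp only: Z(2)[OF y u])
      also have "\<dots> = (x \<otimes> u) \<otimes> y" by (rule m_assoc[OF Z(1)[OF x] u Z(1)[OF y], symmetric])
      also have "\<dots> = (u \<otimes> x) \<otimes> y" by (simp only: Z(2)[OF x u])
      also have "\<dots> = u \<otimes> (x \<otimes> y)" by (rule m_assoc[OF u Z(1)[OF x] Z(1)[OF y]])
      finally show "(x \<otimes> y) \<otimes> u = u \<otimes> (x \<otimes> y)" .
    qed (simp add: Z(1) x y)
  next
    fix c x assume x: "x \<in> algebra_center A"
    show "c \<odot> x \<in> algebra_center A"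
    proof (rule ZI)
      fix u assume u: "u \<in> carrier A"
      show "(c \<odot> x) \<otimes> u = u \<otimes> (c \<odot> x)"
        by (simp only: smult_mult_left[OF Z(1)[OF x] u] smult_mult_right[OF u Z(1)[OF x]] Z(2)[OF x u])
    qed (simp add: Z(1) x complex_ring_simps)
  qed
qed

end

section \<open>Normal ordering\<close>

locale quantum_parameter =
  fixes q :: complex and m :: nat
  assumes q_nonzero: "q \<noteq> 0"
begin

definition eqv :: "free_alg \<Rightarrow> free_alg \<Rightarrow> bool" (infix "\<doteq>" 50) where
  "x \<doteq> y \<longleftrightarrow> x - y \<in> U_ideal q m"

lemma eqv_refl [simp]: "x \<doteq> x"
  by (simp add: eqv_def U_ideal_zero)

lemma eqv_sym: "x \<doteq> y \<Longrightarrow> y \<doteq> x"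
  unfolding eqv_def using U_ideal_uminus[of "x - y"] by simp

lemma eqv_trans [trans]: "x \<doteq> y \<Longrightarrow> y \<doteq> z \<Longrightarrow> x \<doteq> z"
  unfolding eqv_def using U_ideal_add[of "x - y" q m "y - z"] by simp

lemma eqv_mult_left: "x \<doteq> y \<Longrightarrow> a * x \<doteq> a * y"
  unfolding eqv_def using U_ideal_mult_left[of "x - y" q m a] by (simp add: right_diff_distrib)

lemma eqv_mult_right: "x \<doteq> y \<Longrightarrow> x * a \<doteq> y * a"
  unfolding eqv_def using U_ideal_mult_right[of "x - y" q m a] by (simp add: left_diff_distrib)

lemma K_E: "gen GenK * gen GenE \<doteq> scalar (q\<^sup>2) * (gen GenE * gen GenK)"
  and K_F: "gen GenK * gen GenF \<doteq> scalar (inverse (q\<^sup>2)) * (gen GenF * gen GenK)"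
  and K_Kinv: "gen GenK * gen GenKinv \<doteq> 1"
  and Kinv_K: "gen GenKinv * gen GenK \<doteq> 1"
  and E_F: "gen GenE * gen GenF \<doteq> gen GenF * gen GenE + f_poly q m"
  using relators_subset[of q m] by (auto simp: eqv_def relators_def diff_diff_eq)

text \<open>The rule for commuting \<open>x\<close> past an invertible \<open>a\<close> determines the rule for the inverse \<open>b\<close>: multiply
  by \<open>b\<close> on both sides.\<close>

lemma skew_commute_flip:
  assumes "a * x \<doteq> scalar s * (x * a)" "s \<noteq> 0" "a * b \<doteq> 1" "b * a \<doteq> 1"
  shows "x * b \<doteq> scalar s * (b * x)" "b * x \<doteq> scalar (inverse s) * (x * b)"
proof -
  have "x * b = 1 * (x * b)" by simp
  also have "\<dots> \<doteq> (b * a) * (x * b)" by (intro eqv_mult_right eqv_sym[OF assms(4)])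
  also have "(b * a) * (x * b) = b * (a * x) * b" by (simp add: mult.assoc)
  also have "\<dots> \<doteq> b * (scalar s * (x * a)) * b" by (intro eqv_mult_left eqv_mult_right assms)
  also have "\<dots> = (scalar s * (b * x)) * (a * b)" by (simp add: scalar_move mult.assoc)
  also have "\<dots> \<doteq> (scalar s * (b * x)) * 1" by (intro eqv_mult_left assms)
  finally show 1: "x * b \<doteq> scalar s * (b * x)" by simp
  have "scalar (inverse s) * (x * b) \<doteq> scalar (inverse s) * (scalar s * (b * x))"
    by (rule eqv_mult_left[OF 1])
  also have "\<dots> = b * x" using assms(2) by (simp add: scalar_left)
  finally show "b * x \<doteq> scalar (inverse s) * (x * b)" by (rule eqv_sym)
qed

lemma skew_commute_power:
  assumes "a * b \<doteq> scalar s * (b * a)"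
  shows "a * b ^ n \<doteq> scalar (s ^ n) * (b ^ n * a)"
proof (induction n)
  case 0
  then show ?case by simp
next
  case (Suc n)
  have "a * b ^ Suc n = (a * b) * b ^ n" by (simp add: mult.assoc)
  also have "\<dots> \<doteq> (scalar s * (b * a)) * b ^ n" by (intro eqv_mult_right assms)
  also have "\<dots> = (scalar s * b) * (a * b ^ n)" by (simp add: mult.assoc)
  also have "\<dots> \<doteq> (scalar s * b) * (scalar (s ^ n) * (b ^ n * a))" by (intro eqv_mult_left Suc)
  also have "\<dots> = scalar (s ^ Suc n) * (b ^ Suc n * a)"
    by (simp add: mult.assoc scalar_move[of b] scalar_left)
  finally show ?case .
qed

definition Kpow :: "int \<Rightarrow> free_alg" where
  "Kpow j = (if j \<ge> 0 then gen GenK ^ nat j else gen GenKinv ^ nat (- j))"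

lemma K_Kpow: "gen GenK * Kpow j \<doteq> Kpow (j + 1)"
proof (cases "j \<ge> 0")
  case True
  then show ?thesis by (simp add: Kpow_def nat_add_distrib)
next
  case False
  then have n: "nat (- j) = Suc (nat (- j - 1))" by simp
  have "gen GenK * Kpow j = (gen GenK * gen GenKinv) * gen GenKinv ^ nat (- j - 1)"
    using False by (simp add: Kpow_def n mult.assoc)
  also have "\<dots> \<doteq> 1 * gen GenKinv ^ nat (- j - 1)" by (rule eqv_mult_right[OF K_Kinv])
  also have "\<dots> = Kpow (j + 1)" using False by (auto simp: Kpow_def)
  finally show ?thesis .
qed

lemma Kinv_Kpow: "gen GenKinv * Kpow j \<doteq> Kpow (j - 1)"
proof (cases "j > 0")
  case False
  then have "nat (1 - j) = Suc (nat (- j))" by simp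
  with False show ?thesis by (cases "j = 0") (simp_all add: Kpow_def)
next
  case True
  then have n: "nat j = Suc (nat (j - 1))" by simp
  have "gen GenKinv * Kpow j = (gen GenKinv * gen GenK) * gen GenK ^ nat (j - 1)"
    using True by (simp add: Kpow_def n mult.assoc)
  also have "\<dots> \<doteq> 1 * gen GenK ^ nat (j - 1)" by (rule eqv_mult_right[OF Kinv_K])
  also have "\<dots> = Kpow (j - 1)" using True by (auto simp: Kpow_def)
  finally show ?thesis .
qed

lemma E_Kpow: "\<exists>s. gen GenE * Kpow j \<doteq> scalar s * (Kpow j * gen GenE)"
proof -
  have 1: "gen GenE * gen GenKinv \<doteq> scalar (q\<^sup>2) * (gen GenKinv * gen GenE)"
    using skew_commute_flip(1)[OF K_E _ K_Kinv Kinv_K] q_nonzero by simp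
  have 2: "gen GenE * gen GenK \<doteq> scalar (inverse (q\<^sup>2)) * (gen GenK * gen GenE)"
    using eqv_sym[OF eqv_mult_left[OF K_E, of "scalar (inverse (q\<^sup>2))"]] q_nonzero
    by (simp add: scalar_left)
  show ?thesis
    using skew_commute_power[OF 1] skew_commute_power[OF 2] by (auto simp: Kpow_def)
qed

definition mon :: "nat \<times> int \<times> nat \<Rightarrow> free_alg" where
  "mon = (\<lambda>(i, j, l). gen GenF ^ i * Kpow j * gen GenE ^ l)"

text \<open>The ideal is included in the spanning set, so that this is the full preimage in the free algebra of
  the span of the monomials \<open>F^i K^j E^l\<close>. The set \<open>L\<close> of admissible exponents of \<open>E\<close> allows one
  argument to treat both \<open>U\<close> (all exponents) and the subalgebra generated by \<open>F, K, K\<inverse>\<close> (exponent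
  zero only).\<close>

definition normal_span :: "nat set \<Rightarrow> free_alg set" where
  "normal_span L = fa.span (mon ` {(i, j, l). l \<in> L} \<union> U_ideal q m)"

lemma mon_in_normal_span: "l \<in> L \<Longrightarrow> mon (i, j, l) \<in> normal_span L"
  unfolding normal_span_def by (intro fa.span_base) auto

lemma normal_span_ideal: "x \<in> U_ideal q m \<Longrightarrow> x \<in> normal_span L"
  unfolding normal_span_def by (intro fa.span_base) auto

lemma normal_span_add: "x \<in> normal_span L \<Longrightarrow> y \<in> normal_span L \<Longrightarrow> x + y \<in> normal_span L"
  unfolding normal_span_def by (rule fa.span_add)

lemma normal_span_diff: "x \<in> normal_span L \<Longrightarrow> y \<in> normal_span L \<Longrightarrow> x - y \<in> normal_span L"
  unfolding normal_span_def by (rule fa.span_diff)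

lemma normal_span_scale: "x \<in> normal_span L \<Longrightarrow> scalar c * x \<in> normal_span L"
  unfolding normal_span_def by (rule fa.span_scale)

lemma normal_span_zero: "0 \<in> normal_span L"
  unfolding normal_span_def by (rule fa.span_zero)

lemma normal_span_eqv: "x \<doteq> y \<Longrightarrow> y \<in> normal_span L \<Longrightarrow> x \<in> normal_span L"
  unfolding eqv_def using normal_span_add[of "x - y" L y] normal_span_ideal by simp

lemma normal_span_mult_closed:
  assumes "\<And>i j l. l \<in> L \<Longrightarrow> g * mon (i, j, l) \<in> normal_span L" and "x \<in> normal_span L"
  shows "g * x \<in> normal_span L"
proof -
  have "fa.subspace {x. g * x \<in> normal_span L}"
    by (auto simp: fa.subspace_def distrib_left scalar_move
        intro: normal_span_zero normal_span_add normal_span_scale)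
  moreover have "g * y \<in> normal_span L" if "y \<in> mon ` {(i, j, l). l \<in> L} \<union> U_ideal q m" for y
    using that assms(1) by (auto intro: normal_span_ideal U_ideal_mult_left)
  ultimately show ?thesis
    by (rule fa.span_induct[OF assms(2)[unfolded normal_span_def]])
qed

lemma normal_span_F:
  assumes "x \<in> normal_span L" shows "gen GenF * x \<in> normal_span L"
proof (rule normal_span_mult_closed[OF _ assms])
  fix i j l assume "l \<in> L"
  then show "gen GenF * mon (i, j, l) \<in> normal_span L"
    using mon_in_normal_span[of l L "Suc i" j] by (simp add: mon_def mult.assoc)
qed

text \<open>For \<open>K\<close> and its inverse: such a \<open>g\<close> passes the powers of \<open>F\<close> up to a scalar and is then
  absorbed by the power of \<open>K\<close>, so that the exponent of \<open>E\<close> stays the same.\<close>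

lemma normal_span_skew:
  assumes "g * gen GenF \<doteq> scalar s * (gen GenF * g)" and "\<And>j. \<exists>j'. g * Kpow j \<doteq> Kpow j'"
    and "x \<in> normal_span L"
  shows "g * x \<in> normal_span L"
proof (rule normal_span_mult_closed[OF _ assms(3)])
  fix i j l assume l: "l \<in> L"
  obtain j' where j': "g * Kpow j \<doteq> Kpow j'" using assms(2) by blast
  have "g * mon (i, j, l) = (g * gen GenF ^ i) * (Kpow j * gen GenE ^ l)"
    by (simp add: mon_def mult.assoc)
  also have "\<dots> \<doteq> (scalar (s ^ i) * (gen GenF ^ i * g)) * (Kpow j * gen GenE ^ l)"
    by (rule eqv_mult_right[OF skew_commute_power[OF assms(1)]])
  also have "\<dots> = (scalar (s ^ i) * gen GenF ^ i) * ((g * Kpow j) * gen GenE ^ l)"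
    by (simp add: mult.assoc)
  also have "\<dots> \<doteq> (scalar (s ^ i) * gen GenF ^ i) * (Kpow j' * gen GenE ^ l)"
    by (intro eqv_mult_left eqv_mult_right j')
  also have "\<dots> = scalar (s ^ i) * mon (i, j', l)"
    by (simp add: mon_def mult.assoc)
  finally show "g * mon (i, j, l) \<in> normal_span L"
    by (rule normal_span_eqv) (intro normal_span_scale mon_in_normal_span l)
qed

lemma normal_span_K: "x \<in> normal_span L \<Longrightarrow> gen GenK * x \<in> normal_span L"
  by (rule normal_span_skew[OF K_F]) (auto intro: K_Kpow)

lemma normal_span_Kinv: "x \<in> normal_span L \<Longrightarrow> gen GenKinv * x \<in> normal_span L"
  using skew_commute_flip(2)[OF K_F _ K_Kinv Kinv_K] q_nonzero
  by (intro normal_span_skew[of _ "q\<^sup>2"]) (auto intro: Kinv_Kpow)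

lemma normal_span_f:
  assumes "x \<in> normal_span L" shows "f_poly q m * x \<in> normal_span L"
proof -
  have "gen GenK ^ n * x \<in> normal_span L" "gen GenKinv ^ n * x \<in> normal_span L" for n
    by (induction n) (auto simp: assms mult.assoc intro: normal_span_K normal_span_Kinv)
  then show ?thesis
    by (auto simp: f_poly_def mult.assoc left_diff_distrib intro!: normal_span_scale normal_span_diff)
qed

text \<open>The commutator formula for \<open>E\<close> and \<open>F^i\<close> is avoided by an induction on \<open>i\<close>:
  \<open>E F x = F E x + f(K) x\<close>, and the span is already known to be closed under \<open>F\<close> and \<open>f(K)\<close>.\<close>

lemma normal_span_E:
  assumes "x \<in> normal_span UNIV" shows "gen GenE * x \<in> normal_span UNIV"
proof (rule normal_span_mult_closed[OF _ assms])
  fix i j l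
  show "gen GenE * mon (i, j, l) \<in> normal_span UNIV"
  proof (induction i)
    case 0
    obtain s where s: "gen GenE * Kpow j \<doteq> scalar s * (Kpow j * gen GenE)"
      using E_Kpow by blast
    have "gen GenE * mon (0, j, l) \<doteq> scalar s * mon (0, j, Suc l)"
      using eqv_mult_right[OF s, of "gen GenE ^ l"] by (simp add: mon_def mult.assoc)
    then show ?case
      by (rule normal_span_eqv) (intro normal_span_scale mon_in_normal_span UNIV_I)
  next
    case (Suc i)
    let ?x = "mon (i, j, l)"
    have "gen GenE * mon (Suc i, j, l) = (gen GenE * gen GenF) * ?x"
      by (simp add: mon_def mult.assoc)
    also have "\<dots> \<doteq> (gen GenF * gen GenE + f_poly q m) * ?x"
      by (rule eqv_mult_right[OF E_F])
    also have "\<dots> = gen GenF * (gen GenE * ?x) + f_poly q m * ?x"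
      by (simp add: distrib_right mult.assoc)
    finally show ?case
      by (rule normal_span_eqv)
         (intro normal_span_add normal_span_F Suc normal_span_f mon_in_normal_span UNIV_I)
  qed
qed

lemma one_in_normal_span: "0 \<in> L \<Longrightarrow> 1 \<in> normal_span L"
  using mon_in_normal_span[of 0 L 0 0] by (simp add: mon_def Kpow_def)

text \<open>The span contains \<open>1\<close> and is a left ideal.\<close>

lemma normal_span_UNIV: "x \<in> normal_span UNIV"
proof (induction x rule: free_alg_induct)
  case zero
  show ?case by (rule normal_span_zero)
next
  case (single w c)
  obtain gs where w: "w = Word gs" by (cases w)
  have "Poly_Mapping.single (Word gs) 1 \<in> normal_span UNIV"
  proof (induction gs)
    case Nil
    then show ?case using one_in_normal_span[of UNIV] by (simp flip: zero_word_def)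
  next
    case (Cons g gs)
    have eq: "Poly_Mapping.single (Word (g # gs)) 1 = gen g * Poly_Mapping.single (Word gs) 1"
      by (simp add: mult_single)
    show ?case
      unfolding eq using Cons normal_span_E normal_span_F normal_span_K normal_span_Kinv
      by (cases g) auto
  qed
  from normal_span_scale[OF this, of c] show ?case by (simp add: w mult_single)
next
  case (add x y)
  then show ?case by (rule normal_span_add)
qed

text \<open>The coefficients are a function on all index triples that vanishes off \<open>S\<close>, so that a single
  coefficient can be named without asking whether its index lies in \<open>S\<close>.\<close>

lemma normal_form:
  assumes "x \<in> normal_span L"
  shows "\<exists>S r. finite S \<and> (\<forall>t. t \<notin> S \<longrightarrow> r t = 0) \<and> (\<forall>(i, j, l)\<in>S. l \<in> L) \<and>
    x \<doteq> (\<Sum>t\<in>S. scalar (r t) * mon t)"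
proof -
  let ?P = "\<lambda>x S r. finite S \<and> (\<forall>t. t \<notin> S \<longrightarrow> r t = 0) \<and> (\<forall>(i, j, l)\<in>S. l \<in> L) \<and>
    x \<doteq> (\<Sum>t\<in>S. scalar (r t) * mon t)"
  show "\<exists>S r. ?P x S r"
    using assms[unfolded normal_span_def]
  proof (induction rule: fa.span_induct_alt)
    case base
    show ?case by (intro exI[of _ "{}"] exI[of _ "\<lambda>_. 0"]) simp
  next
    case (step c x y)
    from step(2) obtain S r where Sr: "?P y S r" by blast
    from step(1) show ?case
    proof
      assume "x \<in> U_ideal q m"
      then have "scalar c * x + y \<doteq> y"
        by (simp add: eqv_def U_ideal_mult_left)
      with Sr show ?thesis using eqv_trans by blast
    next
      assume "x \<in> mon ` {(i, j, l). l \<in> L}"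
      then obtain t where t: "x = mon t" "t \<in> {(i, j, l). l \<in> L}" by blast
      let ?S = "insert t S" and ?r = "r(t := r t + c)"
      have "(\<Sum>u\<in>?S. scalar (?r u) * mon u) =
          (\<Sum>u\<in>?S. scalar (r u) * mon u + (if u = t then scalar c * mon t else 0))"
        by (intro sum.cong) (auto simp: scalar_add distrib_right)
      also have "\<dots> = (\<Sum>u\<in>?S. scalar (r u) * mon u) + scalar c * mon t"
        using Sr by (simp add: sum.distrib)
      also have "(\<Sum>u\<in>?S. scalar (r u) * mon u) = (\<Sum>u\<in>S. scalar (r u) * mon u)"
        using Sr by (intro sum.mono_neutral_right) auto
      finally have "scalar c * x + y \<doteq> (\<Sum>u\<in>?S. scalar (?r u) * mon u)"
        using Sr by (simp add: t eqv_def algebra_simps)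
      then have "?P (scalar c * x + y) ?S ?r"
        using Sr t by auto
      then show ?thesis by blast
    qed
  qed
qed

end

section \<open>The universal Whittaker module\<close>

locale whittaker_module = quantum_parameter +
  fixes c :: complex
begin

text \<open>All functions are admitted as vectors, so that this is the completion of the universal Whittaker
  module by infinite sums; its generator \<open>w\<close> is the vector \<open>basis 0 0\<close> below.
  The generators of the algebra act on the coefficients \<open>v (i, j)\<close> of the vector
  \<open>\<Sum> v (i, j) F^i K^j w\<close>, where \<open>E w = c w\<close>. For \<open>F\<close> and \<open>K\<close> the formula expresses left multiplication; the one for \<open>E\<close> comes from
  \<open>E F^i K^j w = c q^(-2j) F^i K^j w + F^(i-1) (f(K) + f(q^(-2) K) + ... + f(q^(-2(i-1)) K)) K^j w\<close>.\<close>

fun whittaker_op :: "generator \<Rightarrow> (nat \<times> int) vec \<Rightarrow> (nat \<times> int) vec" where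
  "whittaker_op GenF v = (\<lambda>(i, j). if i = 0 then 0 else v (i - 1, j))"
| "whittaker_op GenK v = (\<lambda>(i, j). inverse (q\<^sup>2) ^ i * v (i, j - 1))"
| "whittaker_op GenKinv v = (\<lambda>(i, j). (q\<^sup>2) ^ i * v (i, j + 1))"
| "whittaker_op GenE v = (\<lambda>(i, j). c * (q\<^sup>2) powi (- j) * v (i, j) +
     ((\<Sum>t\<le>i. inverse (q\<^sup>2) ^ (t * m)) * v (i + 1, j - int m) -
      (\<Sum>t\<le>i. (q\<^sup>2) ^ (t * m)) * v (i + 1, j + int m)) / (q - inverse q))"

sublocale free_module whittaker_op
proof
  fix g and a b :: complex and u v :: "(nat \<times> int) vec"
  show "whittaker_op g (\<lambda>p. a * u p + b * v p) = (\<lambda>p. a * whittaker_op g u p + b * whittaker_op g v p)"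
    by (cases g) (auto simp: fun_eq_iff algebra_simps add_divide_distrib diff_divide_distrib)
qed

abbreviation act :: "free_alg \<Rightarrow> (nat \<times> int) vec \<Rightarrow> (nat \<times> int) vec" where
  "act \<equiv> free_act whittaker_op"

lemma act_K_power: "act (gen GenK ^ n) v (i, j) = inverse (q\<^sup>2) ^ (i * n) * v (i, j - int n)"
  by (induction n arbitrary: j) (simp_all add: free_act_mult power_add algebra_simps)

lemma act_Kinv_power: "act (gen GenKinv ^ n) v (i, j) = (q\<^sup>2) ^ (i * n) * v (i, j + int n)"
  by (induction n arbitrary: j) (simp_all add: free_act_mult power_add algebra_simps)

lemma act_relator:
  assumes "r \<in> relators q m"
  shows "act r v = (\<lambda>p. 0)"
proof
  fix p :: "nat \<times> int"
  obtain i j where p: "p = (i, j)" by (cases p)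
  have Q: "q\<^sup>2 \<noteq> 0" using q_nonzero by simp
  note act_simps = p free_act_diff free_act_mult free_act_scalar
  have KE: "act (gen GenK * gen GenE - scalar (q\<^sup>2) * (gen GenE * gen GenK)) v p = 0"
  proof -
    \<comment> \<open>one factor \<open>q^2\<close> is split off from each power, so that both sides contain the same powers\<close>
    have "(q\<^sup>2) powi (1 - j) = q\<^sup>2 * (q\<^sup>2) powi (- j)"
      using Q by (simp add: power_int_diff power_int_minus divide_inverse)
    moreover have "inverse (q\<^sup>2) ^ i = q\<^sup>2 * inverse (q\<^sup>2) ^ Suc i"
      using Q by simp
    ultimately show ?thesis
      by (simp add: act_simps divide_inverse algebra_simps del: power_Suc)
  qed
  have KF: "act (gen GenK * gen GenF - scalar (inverse (q\<^sup>2)) * (gen GenF * gen GenK)) v p = 0"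
    using Q by (cases i) (simp_all add: act_simps)
  have KK: "act (gen GenK * gen GenKinv - 1) v p = 0" "act (gen GenKinv * gen GenK - 1) v p = 0"
    using Q by (simp_all add: act_simps power_inverse)
  have "act (f_poly q m) v (i, j) =
      (inverse (q\<^sup>2) ^ (i * m) * v (i, j - int m) - (q\<^sup>2) ^ (i * m) * v (i, j + int m)) / (q - inverse q)"
    by (simp add: act_simps f_poly_def act_K_power act_Kinv_power)
  then have EF: "act (gen GenE * gen GenF - gen GenF * gen GenE - f_poly q m) v p = 0"
    by (cases i) (simp_all add: act_simps free_act_add divide_inverse algebra_simps)
  show "act r v p = 0"
    using assms KE KF KK EF unfolding relators_def by auto
qed

text \<open>The elements of the free algebra that act as zero form an ideal containing the relators.\<close>

lemma act_U_ideal: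
  assumes "x \<in> U_ideal q m"
  shows "act x v = (\<lambda>p. 0)"
proof -
  have "ideal {x. \<forall>v. act x v = (\<lambda>p. 0)} free_algebra"
    by (rule ideal_free_algebraI) (auto simp: free_act_add free_act_mult free_act_vec_zero)
  then have "U_ideal q m \<subseteq> {x. \<forall>v. act x v = (\<lambda>p. 0)}"
    by (rule U_ideal_minimal) (auto simp: act_relator)
  with assms show ?thesis by blast
qed

lemma act_eqv: "x \<doteq> y \<Longrightarrow> act x v = act y v"
  using act_U_ideal[of "x - y" v] by (simp add: eqv_def free_act_diff fun_eq_iff)

definition basis :: "nat \<Rightarrow> int \<Rightarrow> (nat \<times> int) vec" where
  "basis i j = (\<lambda>p. if p = (i, j) then 1 else 0)"

lemma act_F_power_basis: "act (gen GenF ^ n) (basis i j) = basis (i + n) j"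
proof (induction n)
  case (Suc n)
  have "whittaker_op GenF (basis (i + n) j) = basis (i + Suc n) j"
    by (auto simp: basis_def fun_eq_iff)
  with Suc show ?case by (simp add: free_act_mult)
qed simp

lemma act_Kpow_basis: "act (Kpow k) (basis 0 j) = basis 0 (j + k)"
proof -
  have "act (gen GenK ^ n) (basis 0 j) = basis 0 (j + int n)" for n
    by (auto simp: fun_eq_iff act_K_power basis_def)
  moreover have "act (gen GenKinv ^ n) (basis 0 j) = basis 0 (j - int n)" for n
    by (auto simp: fun_eq_iff act_Kinv_power basis_def)
  ultimately show ?thesis by (simp add: Kpow_def)
qed

lemma act_E_power_basis:
  "act (gen GenE ^ n) (basis 0 j) = (\<lambda>p. (c * (q\<^sup>2) powi (- j)) ^ n * basis 0 j p)"
proof (induction n)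
  case (Suc n)
  have "whittaker_op GenE (basis 0 j) = (\<lambda>p. c * (q\<^sup>2) powi (- j) * basis 0 j p)"
    by (auto simp: basis_def fun_eq_iff)
  moreover have "act (gen GenE ^ Suc n) (basis 0 j) =
      act (gen GenE) (\<lambda>p. (c * (q\<^sup>2) powi (- j)) ^ n * basis 0 j p)"
    by (simp only: power_Suc free_act_mult Suc)
  ultimately show ?case
    unfolding free_act_vec_scale by (simp add: mult_ac)
qed simp

lemma act_mon_basis:
  "act (mon (i, k, l)) (basis 0 j) = (\<lambda>p. (c * (q\<^sup>2) powi (- j)) ^ l * basis i (j + k) p)"
  by (simp add: mon_def free_act_mult act_E_power_basis free_act_vec_scale act_Kpow_basis
      act_F_power_basis)

text \<open>The coefficient of \<open>F^i K^(j+k) w\<close> in \<open>x K^j w\<close>, as \<open>j\<close> varies, is one fixed polynomial evaluated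
  at the eigenvalue of \<open>E\<close> on \<open>K^j w\<close>; its coefficients are those of the monomials \<open>F^i K^k E^l\<close> in
  the given expression of \<open>x\<close>.\<close>

lemma normal_form_coefficient:
  assumes "finite S" "\<forall>t. t \<notin> S \<longrightarrow> r t = 0" "x \<doteq> (\<Sum>t\<in>S. scalar (r t) * mon t)"
  shows "\<exists>P. (\<forall>l. coeff P l = r (i, k, l)) \<and>
    (\<forall>j. act x (basis 0 j) (i, j + k) = poly P (c * (q\<^sup>2) powi (- j)))"
proof -
  let ?P = "\<Sum>(i', k', l)\<in>S. if (i', k') = (i, k) then Polynomial.monom (r (i, k, l)) l else 0"
  have "act (\<Sum>t\<in>S. f t) v = (\<lambda>p. \<Sum>t\<in>S. act (f t) v p)" for f v
    using assms(1) by (induction S rule: finite_induct) (auto simp: free_act_add)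
  then have act_x: "act x v p = (\<Sum>t\<in>S. act (scalar (r t) * mon t) v p)" for v p
    unfolding act_eqv[OF assms(3)] by simp
  have "act x (basis 0 j) (i, j + k) = poly ?P (c * (q\<^sup>2) powi (- j))" for j
    unfolding act_x poly_sum
  proof (rule sum.cong)
    fix t :: "nat \<times> int \<times> nat"
    obtain i' k' l where t: "t = (i', k', l)" by (cases t)
    have b: "basis i' (j + k') (i, j + k) = (if (i', k') = (i, k) then 1 else 0)"
      by (auto simp: basis_def)
    show "act (scalar (r t) * mon t) (basis 0 j) (i, j + k) =
      poly (case t of (i', k', l) \<Rightarrow> if (i', k') = (i, k) then Polynomial.monom (r (i, k, l)) l else 0)
        (c * (q\<^sup>2) powi (- j))"
      by (simp add: t free_act_mult free_act_scalar act_mon_basis b poly_monom)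
  qed simp
  moreover have "coeff ?P l = r (i, k, l)" for l
  proof -
    have "coeff ?P l = (\<Sum>t\<in>S. if t = (i, k, l) then r t else 0)"
      unfolding coeff_sum by (rule sum.cong) (auto split: if_splits)
    also have "\<dots> = r (i, k, l)" using assms(1,2) by (simp add: sum.delta')
    finally show ?thesis .
  qed
  ultimately show ?thesis by blast
qed

text \<open>When \<open>E\<close> does not occur, the polynomials of \<open>normal_form_coefficient\<close> are constants, and one value
  determines them.\<close>

lemma FK_faithful:
  assumes "x \<in> normal_span {0}" "act x (basis 0 0) = (\<lambda>p. 0)"
  shows "x \<in> U_ideal q m"
proof -
  obtain S r where Sr: "finite S" "\<forall>t. t \<notin> S \<longrightarrow> r t = 0" "x \<doteq> (\<Sum>t\<in>S. scalar (r t) * mon t)"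
    and L: "\<forall>(i, j, l)\<in>S. l \<in> {0}"
    using normal_form[OF assms(1)] by (elim exE conjE) (rule that)
  have "r (i, k, l) = 0" for i k l
  proof (cases "l = 0")
    case False
    then have "(i, k, l) \<notin> S" using bspec[OF L, of "(i, k, l)"] by auto
    then show ?thesis using Sr(2) by simp
  next
    case True
    obtain P where P: "\<forall>l. coeff P l = r (i, k, l)"
      "\<forall>j. act x (basis 0 j) (i, j + k) = poly P (c * (q\<^sup>2) powi (- j))"
      using normal_form_coefficient[OF Sr, of i k] by (elim exE conjE) (rule that)
    have coeff: "coeff P l = 0" if "l \<noteq> 0" for l
    proof -
      have "(i, k, l) \<notin> S" using bspec[OF L, of "(i, k, l)"] that by auto
      then show ?thesis using P(1) Sr(2) by simp
    qed
    have "degree P = 0"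
    proof (rule ccontr)
      assume "degree P \<noteq> 0"
      with coeff[OF this] show False by auto
    qed
    then obtain a where a: "P = [:a:]" by (rule degree_eq_zeroE)
    have "r (i, k, l) = coeff P 0" using P(1) True by simp
    also have "\<dots> = poly P (c * (q\<^sup>2) powi (- 0))" by (simp add: a)
    also have "\<dots> = act x (basis 0 0) (i, 0 + k)" by (rule P(2)[rule_format, symmetric])
    also have "\<dots> = 0" by (simp add: assms(2))
    finally show ?thesis .
  qed
  then have "r = (\<lambda>t. 0)" by (simp add: fun_eq_iff split_paired_All)
  then show ?thesis using Sr(3) by (simp add: eqv_def)
qed

text \<open>The universal Whittaker module is faithful: for \<open>n \<ge> 0\<close> the eigenvalue of \<open>E\<close> on \<open>K^(-n) w\<close> is
  \<open>c q^(2n)\<close>, which gives every polynomial of \<open>normal_form_coefficient\<close> infinitely many roots.\<close>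

lemma whittaker_faithful:
  assumes "c \<noteq> 0" "\<forall>n::nat. n \<ge> 1 \<longrightarrow> q ^ n \<noteq> 1" "\<And>j. act x (basis 0 j) = (\<lambda>p. 0)"
  shows "x \<in> U_ideal q m"
proof -
  obtain S r where Sr: "finite S" "\<forall>t. t \<notin> S \<longrightarrow> r t = 0" "x \<doteq> (\<Sum>t\<in>S. scalar (r t) * mon t)"
    using normal_form[OF normal_span_UNIV[of x]] by (elim exE conjE) (rule that)
  have inj: "inj (\<lambda>n. c * (q\<^sup>2) ^ n)"
  proof (rule linorder_inj_onI')
    fix a b :: nat assume "a < b"
    moreover have "(q\<^sup>2) ^ b = (q\<^sup>2) ^ a * q ^ (2 * (b - a))" if "a < b"
      using that by (simp flip: power_mult power_add add: algebra_simps)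
    ultimately show "c * (q\<^sup>2) ^ a \<noteq> c * (q\<^sup>2) ^ b"
      using assms(1,2) q_nonzero by simp
  qed
  have "r (i, k, l) = 0" for i k l
  proof -
    obtain P where P: "\<forall>l. coeff P l = r (i, k, l)"
      "\<forall>j. act x (basis 0 j) (i, j + k) = poly P (c * (q\<^sup>2) powi (- j))"
      using normal_form_coefficient[OF Sr, of i k] by (elim exE conjE) (rule that)
    have "poly P (c * (q\<^sup>2) ^ n) = 0" for n
      using P(2)[rule_format, of "- int n"] assms(3)[of "- int n"] by simp
    then have "range (\<lambda>n. c * (q\<^sup>2) ^ n) \<subseteq> {z. poly P z = 0}" by auto
    then have "infinite {z. poly P z = 0}"
      using range_inj_infinite[OF inj] finite_subset by blast
    then have "P = 0" using poly_roots_finite by blast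
    with P(1) show ?thesis by simp
  qed
  then have "r = (\<lambda>t. 0)" by (simp add: fun_eq_iff split_paired_All)
  then show ?thesis using Sr(3) by (simp add: eqv_def)
qed

text \<open>A central element that kills the generator kills the translates \<open>K^j w\<close>.\<close>

lemma center_faithful:
  assumes "c \<noteq> 0" "\<forall>n::nat. n \<ge> 1 \<longrightarrow> q ^ n \<noteq> 1"
    and "\<And>y. x * y \<doteq> y * x" "act x (basis 0 0) = (\<lambda>p. 0)"
  shows "x \<in> U_ideal q m"
proof (rule whittaker_faithful[OF assms(1,2)])
  fix j
  have "act x (basis 0 j) = act (x * Kpow j) (basis 0 0)"
    by (simp add: free_act_mult act_Kpow_basis)
  also have "\<dots> = act (Kpow j * x) (basis 0 0)" by (rule act_eqv[OF assms(3)])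
  also have "\<dots> = (\<lambda>p. 0)" by (simp add: free_act_mult assms(4) free_act_vec_zero)
  finally show "act x (basis 0 j) = (\<lambda>p. 0)" .
qed

end

section \<open>The Whittaker projection\<close>

lemma U_gen_eq_cl: "U_gen q m g = cl q m (gen g)"
  by (simp add: U_gen_def cl_def)

locale nonsingular_whittaker = quantum_parameter +
  fixes \<eta> :: "free_alg set \<Rightarrow> complex"
  assumes nonsingular: "nonsingular_character q m \<eta>"
begin

sublocale whittaker_module q m "\<eta> (U_gen q m GenE)" ..

sublocale U: complex_algebra "Uq q m" by (rule complex_algebra_Uq)

abbreviation "UE \<equiv> generated_subalgebra (Uq q m) {U_gen q m GenE}"
abbreviation "UFK \<equiv> generated_subalgebra (Uq q m) {U_gen q m GenF, U_gen q m GenK, U_gen q m GenKinv}"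
abbreviation "left_ideal \<equiv> U_left_ideal q m \<eta>"

lemma Uq_FK_eq: "Uq_FK q m = (Uq q m)\<lparr>carrier := UFK\<rparr>"
  by (simp add: Uq_FK_def)

lemma cl_eq_eqv: "cl q m x = cl q m y \<longleftrightarrow> x \<doteq> y"
  by (simp add: cl_eq_iff eqv_def)

lemma act_cl: "cl q m x = cl q m y \<Longrightarrow> act x v = act y v"
  by (simp add: cl_eq_eqv act_eqv)

lemma subalgebra_UE: "subalgebra_of UE (Uq q m)"
  by (rule U.subalgebra_generated) (auto simp: U_gen_eq_cl Uq_simps)

lemma subalgebra_UFK: "subalgebra_of UFK (Uq q m)"
  by (rule U.subalgebra_generated) (auto simp: U_gen_eq_cl Uq_simps)

lemma subalgebra_cl:
  assumes "subalgebra_of B (Uq q m)"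
  shows "cl q m 1 \<in> B"
    and "cl q m x \<in> B \<Longrightarrow> cl q m y \<in> B \<Longrightarrow> cl q m (x + y) \<in> B"
    and "cl q m x \<in> B \<Longrightarrow> cl q m y \<in> B \<Longrightarrow> cl q m (x * y) \<in> B"
    and "cl q m x \<in> B \<Longrightarrow> cl q m (scalar a * x) \<in> B"
    and "cl q m x \<in> B \<Longrightarrow> cl q m (x ^ n) \<in> B"
    and "cl q m 0 \<in> B"
proof -
  note B = U.subalgebraE[OF assms]
  show 1: "cl q m 1 \<in> B" using B(2) by (simp add: Uq_simps)
  show "cl q m x \<in> B \<Longrightarrow> cl q m y \<in> B \<Longrightarrow> cl q m (x + y) \<in> B"
    using B(3)[of "cl q m x" "cl q m y"] by (simp add: Uq_simps)
  show mult: "cl q m x \<in> B \<Longrightarrow> cl q m y \<in> B \<Longrightarrow> cl q m (x * y) \<in> B" for x y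
    using B(4)[of "cl q m x" "cl q m y"] by (simp add: Uq_simps)
  show "cl q m x \<in> B \<Longrightarrow> cl q m (scalar a * x) \<in> B"
    using B(5)[of "cl q m x" a] by (simp add: Uq_simps)
  show "cl q m x \<in> B \<Longrightarrow> cl q m (x ^ n) \<in> B"
    by (induction n) (use 1 mult in auto)
  show "cl q m 0 \<in> B" using B(5)[OF 1, of 0] by (simp add: Uq_simps)
qed

text \<open>The elements whose left multiplication preserves the span of the \<open>F^i K^j\<close> form a subalgebra that
  contains the generators; such an element lies in the span because \<open>1\<close> does.\<close>

lemma UFK_normal: "cl q m x \<in> UFK \<Longrightarrow> x \<in> normal_span {0}"
proof -
  assume x: "cl q m x \<in> UFK"
  let ?B = "{u. \<exists>x. u = cl q m x \<and> (\<forall>y\<in>normal_span {0}. x * y \<in> normal_span {0})}"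
  have "subalgebra_of ?B (Uq q m)"
  proof (rule U.subalgebraI)
    show "?B \<subseteq> carrier (Uq q m)" by (auto simp: Uq_simps)
    show "\<one>\<^bsub>Uq q m\<^esub> \<in> ?B" by (auto simp: Uq_simps intro: exI[of _ 1])
    fix u v a assume "u \<in> ?B"
    then obtain x where x: "u = cl q m x" "\<And>y. y \<in> normal_span {0} \<Longrightarrow> x * y \<in> normal_span {0}" by blast
    have "\<forall>y\<in>normal_span {0}. (scalar a * x) * y \<in> normal_span {0}"
      using x(2) by (auto simp: mult.assoc intro: normal_span_scale)
    then show "a \<odot>\<^bsub>Uq q m\<^esub> u \<in> ?B" by (auto simp: x(1) Uq_simps)
    assume "v \<in> ?B"
    then obtain x' where x': "v = cl q m x'" "\<And>y. y \<in> normal_span {0} \<Longrightarrow> x' * y \<in> normal_span {0}" by blast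
    have "\<forall>y\<in>normal_span {0}. (x + x') * y \<in> normal_span {0}"
      using x(2) x'(2) by (auto simp: distrib_right intro: normal_span_add)
    then show "u \<oplus>\<^bsub>Uq q m\<^esub> v \<in> ?B" by (auto simp: x(1) x'(1) Uq_simps)
    have "\<forall>y\<in>normal_span {0}. (x * x') * y \<in> normal_span {0}"
      using x(2) x'(2) by (auto simp: mult.assoc)
    then show "u \<otimes>\<^bsub>Uq q m\<^esub> v \<in> ?B" by (auto simp: x(1) x'(1) Uq_simps)
  qed
  moreover have "{U_gen q m GenF, U_gen q m GenK, U_gen q m GenKinv} \<subseteq> ?B"
    unfolding U_gen_eq_cl using normal_span_F normal_span_K normal_span_Kinv by blast
  ultimately have "UFK \<subseteq> ?B" by (rule U.generated_minimal)
  with x obtain x' where x': "x \<doteq> x'" "\<And>y. y \<in> normal_span {0} \<Longrightarrow> x' * y \<in> normal_span {0}"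
    by (auto simp: cl_eq_eqv)
  have "x' * 1 \<in> normal_span {0}" by (rule x'(2)) (rule one_in_normal_span, simp)
  then show "x \<in> normal_span {0}" using normal_span_eqv[OF x'(1)] by simp
qed

lemma eta_simps:
  "\<eta> (cl q m 1) = 1"
  "cl q m x \<in> UE \<Longrightarrow> cl q m y \<in> UE \<Longrightarrow> \<eta> (cl q m (x * y)) = \<eta> (cl q m x) * \<eta> (cl q m y)"
  "cl q m x \<in> UE \<Longrightarrow> cl q m y \<in> UE \<Longrightarrow> \<eta> (cl q m (x + y)) = \<eta> (cl q m x) + \<eta> (cl q m y)"
  "cl q m x \<in> UE \<Longrightarrow> \<eta> (cl q m (scalar a * x)) = a * \<eta> (cl q m x)"
  using nonsingular ring_hom_mult[of \<eta> "Uq_E q m" complex_as_algebra "cl q m x" "cl q m y"]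
    ring_hom_add[of \<eta> "Uq_E q m" complex_as_algebra "cl q m x" "cl q m y"]
    ring_hom_one[of \<eta> "Uq_E q m" complex_as_algebra]
  by (auto simp: nonsingular_character_def algebra_hom_def Uq_E_def Uq_simps complex_as_algebra_def
       simp flip: Uq_simps(6))

text \<open>The elements with this property form a subalgebra that contains \<open>E\<close>: the character \<open>\<eta>\<close> records how the
  subalgebra generated by \<open>E\<close> acts on the generator \<open>w = basis 0 0\<close>.\<close>

lemma UE_whittaker_vector:
  assumes "cl q m x \<in> UE"
  shows "act x (basis 0 0) = (\<lambda>p. \<eta> (cl q m x) * basis 0 0 p)"
proof -
  let ?B = "{u \<in> UE. \<forall>x. u = cl q m x \<longrightarrow> act x (basis 0 0) = (\<lambda>p. \<eta> u * basis 0 0 p)}"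
  have BI: "cl q m x \<in> ?B"
    if "cl q m x \<in> UE" "act x (basis 0 0) = (\<lambda>p. \<eta> (cl q m x) * basis 0 0 p)" for x
    using that act_cl[of x] by fastforce
  have "subalgebra_of ?B (Uq q m)"
  proof (rule U.subalgebraI)
    show "?B \<subseteq> carrier (Uq q m)" using U.subalgebraE(1)[OF subalgebra_UE] by blast
    show "\<one>\<^bsub>Uq q m\<^esub> \<in> ?B"
      unfolding Uq_simps by (rule BI) (simp_all add: subalgebra_cl(1)[OF subalgebra_UE] eta_simps)
    fix u v a assume u: "u \<in> ?B"
    then obtain x where x: "u = cl q m x"
      using U.subalgebraE(1)[OF subalgebra_UE] by (auto simp: Uq_simps)
    show "a \<odot>\<^bsub>Uq q m\<^esub> u \<in> ?B"
      using u unfolding x Uq_simps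
      by (intro BI) (auto simp: subalgebra_cl(4)[OF subalgebra_UE] free_act_mult free_act_scalar eta_simps)
    assume v: "v \<in> ?B"
    then obtain y where y: "v = cl q m y"
      using U.subalgebraE(1)[OF subalgebra_UE] by (auto simp: Uq_simps)
    show "u \<oplus>\<^bsub>Uq q m\<^esub> v \<in> ?B"
      using u v unfolding x y Uq_simps
      by (intro BI) (auto simp: subalgebra_cl(2)[OF subalgebra_UE] free_act_add eta_simps algebra_simps)
    show "u \<otimes>\<^bsub>Uq q m\<^esub> v \<in> ?B"
      using u v unfolding x y Uq_simps
      by (intro BI) (auto simp: subalgebra_cl(3)[OF subalgebra_UE] free_act_mult free_act_vec_scale eta_simps)
  qed
  moreover have "U_gen q m GenE \<in> ?B"
  proof -
    have "cl q m (gen GenE) \<in> ?B"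
    proof (rule BI)
      show "cl q m (gen GenE) \<in> UE" using U.generated_incl[of "{U_gen q m GenE}"] by (simp flip: U_gen_eq_cl)
      show "act (gen GenE) (basis 0 0) = (\<lambda>p. \<eta> (cl q m (gen GenE)) * basis 0 0 p)"
        using act_E_power_basis[of 1 0] by (simp flip: U_gen_eq_cl)
    qed
    then show ?thesis by (simp only: U_gen_eq_cl)
  qed
  ultimately have "UE \<subseteq> ?B" by (intro U.generated_minimal) auto
  with assms show ?thesis by blast
qed

lemma eta_kernel: "Uq_eta_E q m \<eta> = {u \<in> UE. \<eta> u = 0}"
  by (simp add: Uq_eta_E_def a_kernel_def' Uq_E_def complex_as_algebra_def)

text \<open>The kernel of \<open>\<eta>\<close> kills \<open>w\<close>, and therefore so does the left ideal that it generates.\<close>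

lemma left_ideal_cl: "u \<in> left_ideal \<Longrightarrow> \<exists>x. u = cl q m x \<and> act x (basis 0 0) = (\<lambda>p. 0)"
  unfolding U_left_ideal_def
proof (induction rule: ideal_prod.induct)
  case (prod i j)
  then obtain x where x: "i = cl q m x" by (auto simp: Uq_simps)
  have j: "j \<in> UE" "\<eta> j = 0" using prod by (auto simp: eta_kernel)
  then obtain y where y: "j = cl q m y"
    using U.subalgebraE(1)[OF subalgebra_UE] by (auto simp: Uq_simps)
  have "act y (basis 0 0) = (\<lambda>p. 0)" using UE_whittaker_vector[of y] j y by simp
  then show ?case
    by (intro exI[of _ "x * y"]) (simp add: x y Uq_simps free_act_mult free_act_vec_zero)
next
  case (sum s1 s2)
  then obtain x y where "s1 = cl q m x" "act x (basis 0 0) = (\<lambda>p. 0)"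
    "s2 = cl q m y" "act y (basis 0 0) = (\<lambda>p. 0)" by blast
  then show ?case by (intro exI[of _ "x + y"]) (simp add: Uq_simps free_act_add)
qed

lemma left_ideal_add: "cl q m x \<in> left_ideal \<Longrightarrow> cl q m y \<in> left_ideal \<Longrightarrow> cl q m (x + y) \<in> left_ideal"
  unfolding U_left_ideal_def using ideal_prod.sum[of "cl q m x" "Uq q m" _ _ "cl q m y"] by (simp add: Uq_simps(3))

lemma left_ideal_carrier: "u \<in> left_ideal \<Longrightarrow> u \<in> carrier (Uq q m)"
  using left_ideal_cl[of u] by (auto simp: Uq_simps)

lemma left_ideal_absorbs:
  assumes v: "v \<in> carrier (Uq q m)" and u: "u \<in> left_ideal"
  shows "v \<otimes>\<^bsub>Uq q m\<^esub> u \<in> left_ideal"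
  using u unfolding U_left_ideal_def
proof (induction rule: ideal_prod.induct)
  case (prod i j)
  have "j \<in> carrier (Uq q m)"
    using prod(2) U.subalgebraE(1)[OF subalgebra_UE] by (auto simp: eta_kernel)
  then have "v \<otimes>\<^bsub>Uq q m\<^esub> (i \<otimes>\<^bsub>Uq q m\<^esub> j) = (v \<otimes>\<^bsub>Uq q m\<^esub> i) \<otimes>\<^bsub>Uq q m\<^esub> j"
    by (intro U.m_assoc[symmetric] v prod)
  then show ?case
    using ideal_prod.prod[OF U.m_closed[OF v prod(1)] prod(2)] by (simp only:)
next
  case (sum s1 s2)
  then have "v \<otimes>\<^bsub>Uq q m\<^esub> (s1 \<oplus>\<^bsub>Uq q m\<^esub> s2) = v \<otimes>\<^bsub>Uq q m\<^esub> s1 \<oplus>\<^bsub>Uq q m\<^esub> v \<otimes>\<^bsub>Uq q m\<^esub> s2"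
    by (intro U.r_distr left_ideal_carrier v) (simp_all only: U_left_ideal_def)
  then show ?case using ideal_prod.sum[OF sum(3,4)] by (simp only:)
qed

lemma left_ideal_mult: "cl q m x \<in> left_ideal \<Longrightarrow> cl q m (a * x) \<in> left_ideal"
  using left_ideal_absorbs[of "cl q m a" "cl q m x"] by (simp add: Uq_simps)

lemma left_ideal_zero: "cl q m 0 \<in> left_ideal"
proof -
  have "\<eta> (cl q m 0) = 0"
    using eta_simps(4)[OF subalgebra_cl(1)[OF subalgebra_UE], of 0] by simp
  then have "cl q m 1 \<otimes>\<^bsub>Uq q m\<^esub> cl q m 0 \<in> left_ideal"
    unfolding U_left_ideal_def using subalgebra_cl(6)[OF subalgebra_UE]
    by (intro ideal_prod.prod) (auto simp: eta_kernel Uq_simps)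
  then show ?thesis by (simp add: Uq_simps)
qed

lemma left_ideal_diff: "cl q m x \<in> left_ideal \<Longrightarrow> cl q m y \<in> left_ideal \<Longrightarrow> cl q m (x - y) \<in> left_ideal"
  using left_ideal_add[of x "- 1 * y"] left_ideal_mult[of y "- 1"] by simp

lemma UFK_diff: "cl q m x \<in> UFK \<Longrightarrow> cl q m y \<in> UFK \<Longrightarrow> cl q m (x - y) \<in> UFK"
  using subalgebra_cl(2)[OF subalgebra_UFK, of x "scalar (- 1) * y"]
    subalgebra_cl(4)[OF subalgebra_UFK, of y "- 1"] by (simp add: single_uminus)

lemma UFK_inter_left_ideal: "cl q m x \<in> UFK \<Longrightarrow> cl q m x \<in> left_ideal \<Longrightarrow> x \<doteq> 0"
proof -
  assume x: "cl q m x \<in> UFK" "cl q m x \<in> left_ideal"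
  then have "act x (basis 0 0) = (\<lambda>p. 0)"
    using left_ideal_cl act_cl by metis
  with FK_faithful[OF UFK_normal[OF x(1)]] show "x \<doteq> 0" by (simp add: eqv_def)
qed

text \<open>Modulo the left ideal, \<open>E^l\<close> may be replaced by the scalar \<open>\<eta> (E^l)\<close> at the right end of a monomial
  \<open>F^i K^j E^l\<close>.\<close>

lemma decomposition: "\<exists>a. cl q m a \<in> UFK \<and> cl q m (x - a) \<in> left_ideal"
proof -
  let ?D = "{x. \<exists>a. cl q m a \<in> UFK \<and> cl q m (x - a) \<in> left_ideal}"
  have UFK_gen: "cl q m (gen g) \<in> UFK" if "g \<in> {GenF, GenK, GenKinv}" for g
    using U.generated_incl[of "{U_gen q m GenF, U_gen q m GenK, U_gen q m GenKinv}"] that by (auto simp: U_gen_eq_cl)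
  have sub: "fa.subspace ?D"
    unfolding fa.subspace_def
  proof (intro conjI ballI allI)
    show "0 \<in> ?D" using left_ideal_zero subalgebra_cl(6)[OF subalgebra_UFK]
      by (intro CollectI exI[of _ 0]) simp
    fix x s assume "x \<in> ?D"
    then obtain a where a: "cl q m a \<in> UFK" "cl q m (x - a) \<in> left_ideal" by blast
    show "scalar s * x \<in> ?D"
      using left_ideal_mult[OF a(2), of "scalar s"] subalgebra_cl(4)[OF subalgebra_UFK a(1), of s]
      by (auto simp: right_diff_distrib)
    fix y assume "y \<in> ?D"
    then obtain b where b: "cl q m b \<in> UFK" "cl q m (y - b) \<in> left_ideal" by blast
    show "x + y \<in> ?D"
      using left_ideal_add[OF a(2) b(2)] subalgebra_cl(2)[OF subalgebra_UFK a(1) b(1)]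
      by (intro CollectI exI[of _ "a + b"]) (simp add: algebra_simps)
  qed
  have D_ideal: "x \<in> ?D" if x: "x \<in> U_ideal q m" for x
  proof -
    have "cl q m x = cl q m 0" using x by (simp add: cl_eq_iff)
    then show ?thesis using left_ideal_zero subalgebra_cl(6)[OF subalgebra_UFK]
      by (intro CollectI exI[of _ 0]) simp
  qed
  have D_mon: "mon t \<in> ?D" for t
  proof -
    obtain i j l where t: "t = (i, j, l)" by (cases t)
    let ?c = "\<eta> (U_gen q m GenE) ^ l" and ?b = "gen GenF ^ i * Kpow j"
    have E: "cl q m (gen GenE) \<in> UE"
      using U.generated_incl[of "{U_gen q m GenE}"] by (simp add: U_gen_eq_cl)
    have pow: "cl q m (gen GenE ^ n) \<in> UE" for n by (rule subalgebra_cl(5)[OF subalgebra_UE E])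
    have eta_pow: "\<eta> (cl q m (gen GenE ^ n)) = \<eta> (U_gen q m GenE) ^ n" for n
    proof (induction n)
      case (Suc n)
      then show ?case using eta_simps(2)[OF E pow] by (simp add: U_gen_eq_cl)
    qed (simp add: eta_simps)
    let ?k = "gen GenE ^ l + scalar (- ?c) * 1"
    have "cl q m (scalar (- ?c) * 1) \<in> UE"
      by (intro subalgebra_cl(4)[OF subalgebra_UE] subalgebra_cl(1)[OF subalgebra_UE])
    then have "cl q m ?k \<in> Uq_eta_E q m \<eta>"
      using subalgebra_cl(2)[OF subalgebra_UE pow, of "scalar (- ?c) * 1" l]
        eta_simps(3)[OF pow, of "scalar (- ?c) * 1" l] eta_simps(4)[of 1 "- ?c"]
        eta_simps(1) subalgebra_cl(1)[OF subalgebra_UE] eta_pow[of l]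
      by (simp add: eta_kernel)
    then have "cl q m ?b \<otimes>\<^bsub>Uq q m\<^esub> cl q m ?k \<in> left_ideal"
      unfolding U_left_ideal_def by (intro ideal_prod.prod) (auto simp: Uq_simps)
    moreover have "?b * ?k = mon t - scalar ?c * ?b"
      by (simp add: mon_def t right_diff_distrib single_uminus scalar_comm)
    ultimately have "cl q m (mon t - scalar ?c * ?b) \<in> left_ideal" by (simp add: Uq_simps)
    moreover have "cl q m ?b \<in> UFK"
      unfolding Kpow_def by (auto intro!: subalgebra_cl(3,5)[OF subalgebra_UFK] UFK_gen)
    ultimately show ?thesis using subalgebra_cl(4)[OF subalgebra_UFK] by blast
  qed
  have "x \<in> fa.span (mon ` {(i, j, l). l \<in> UNIV} \<union> U_ideal q m)"
    using normal_span_UNIV[of x] by (simp only: normal_span_def)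
  moreover have "mon ` {(i, j, l). l \<in> UNIV} \<union> U_ideal q m \<subseteq> ?D"
    using D_ideal D_mon by blast
  ultimately have "x \<in> ?D" using fa.span_minimal[OF _ sub] by blast
  then show ?thesis by simp
qed

text \<open>By \<open>UFK_inter_left_ideal\<close> the definite description picks out the component \<open>a\<close>; this lemma and
  \<open>decomposition\<close> are the interface to the projection from here on.\<close>

lemma proj_eq:
  assumes "cl q m a \<in> UFK" "cl q m (x - a) \<in> left_ideal"
  shows "whittaker_proj q m \<eta> (cl q m x) = cl q m a"
  unfolding whittaker_proj_def
proof (rule the_equality)
  show "cl q m a \<in> carrier (Uq_FK q m) \<and> (\<exists>b\<in>left_ideal. cl q m x = cl q m a \<oplus>\<^bsub>Uq q m\<^esub> b)"
    using assms by (auto simp: Uq_FK_eq Uq_simps intro!: bexI[of _ "cl q m (x - a)"])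
next
  fix u assume u: "u \<in> carrier (Uq_FK q m) \<and> (\<exists>b\<in>left_ideal. cl q m x = u \<oplus>\<^bsub>Uq q m\<^esub> b)"
  then obtain a' where a': "u = cl q m a'" "cl q m a' \<in> UFK"
    using U.subalgebraE(1)[OF subalgebra_UFK] by (auto simp: Uq_FK_eq Uq_simps)
  from u obtain b where b: "cl q m b \<in> left_ideal" "cl q m x = u \<oplus>\<^bsub>Uq q m\<^esub> cl q m b"
    using left_ideal_cl by metis
  have "x - (a' + b) \<in> U_ideal q m" using b(2) by (simp add: a' Uq_simps cl_eq_iff)
  then have "(x - a') - b \<in> U_ideal q m" by (simp add: algebra_simps)
  then have "cl q m (x - a') \<in> left_ideal" using b(1) by (simp flip: cl_eq_iff)
  then have "cl q m (a' - a) \<in> left_ideal" using left_ideal_diff[OF assms(2), of "x - a'"] by simp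
  moreover have "cl q m (a' - a) \<in> UFK" by (rule UFK_diff[OF a'(2) assms(1)])
  ultimately have "a' - a \<doteq> 0" by (intro UFK_inter_left_ideal)
  then show "u = cl q m a" by (simp add: a' cl_eq_iff eqv_def)
qed

lemma proj_add:
  "whittaker_proj q m \<eta> (cl q m (x + y)) =
   whittaker_proj q m \<eta> (cl q m x) \<oplus>\<^bsub>Uq q m\<^esub> whittaker_proj q m \<eta> (cl q m y)"
proof -
  obtain a b where a: "cl q m a \<in> UFK" "cl q m (x - a) \<in> left_ideal" and b: "cl q m b \<in> UFK" "cl q m (y - b) \<in> left_ideal"
    using decomposition by metis
  have "cl q m (x + y - (a + b)) \<in> left_ideal" using left_ideal_add[OF a(2) b(2)] by (simp add: algebra_simps)
  then show ?thesis
    using proj_eq[OF a] proj_eq[OF b] proj_eq[OF subalgebra_cl(2)[OF subalgebra_UFK a(1) b(1)]]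
    by (simp add: Uq_simps)
qed

lemma proj_scale:
  "whittaker_proj q m \<eta> (cl q m (scalar s * x)) = s \<odot>\<^bsub>Uq q m\<^esub> whittaker_proj q m \<eta> (cl q m x)"
proof -
  obtain a where a: "cl q m a \<in> UFK" "cl q m (x - a) \<in> left_ideal" using decomposition by metis
  have "cl q m (scalar s * x - scalar s * a) \<in> left_ideal"
    using left_ideal_mult[OF a(2), of "scalar s"] by (simp add: right_diff_distrib)
  then show ?thesis
    using proj_eq[OF a] proj_eq[OF subalgebra_cl(4)[OF subalgebra_UFK a(1)]] by (simp add: Uq_simps)
qed

lemma proj_one: "whittaker_proj q m \<eta> (cl q m 1) = cl q m 1"
  by (rule proj_eq) (simp_all add: subalgebra_cl(1)[OF subalgebra_UFK] left_ideal_zero)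

lemma proj_in_UFK: "whittaker_proj q m \<eta> (cl q m x) \<in> UFK"
  using decomposition[of x] proj_eq by auto

text \<open>Write \<open>a, b\<close> for the projections of \<open>x, y\<close>. Modulo the left ideal, \<open>x y = y x\<close> becomes
  \<open>y a = a y\<close> and then \<open>a b\<close>. The centrality of \<open>y\<close> is used twice, so that in both steps the factor
  to be replaced stands on the right.\<close>

lemma proj_mult_central:
  assumes "\<And>u. y * u \<doteq> u * y"
  shows "whittaker_proj q m \<eta> (cl q m (x * y)) =
    whittaker_proj q m \<eta> (cl q m x) \<otimes>\<^bsub>Uq q m\<^esub> whittaker_proj q m \<eta> (cl q m y)"
proof -
  obtain a b where a: "cl q m a \<in> UFK" "cl q m (x - a) \<in> left_ideal" and b: "cl q m b \<in> UFK" "cl q m (y - b) \<in> left_ideal"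
    using decomposition by metis
  have "x * y \<doteq> y * (x - a) + y * a" using eqv_sym[OF assms[of x]] by (simp add: right_diff_distrib)
  moreover have "y * a \<doteq> a * (y - b) + a * b" using assms[of a] by (simp add: right_diff_distrib)
  ultimately have "(x * y - (y * (x - a) + y * a)) + (y * a - (a * (y - b) + a * b)) \<in> U_ideal q m"
    unfolding eqv_def by (rule U_ideal_add)
  then have "(x * y - a * b) - (y * (x - a) + a * (y - b)) \<in> U_ideal q m"
    by (simp add: algebra_simps)
  then have "cl q m (x * y - a * b) = cl q m (y * (x - a) + a * (y - b))"
    by (simp only: cl_eq_iff)
  also have "\<dots> \<in> left_ideal" by (intro left_ideal_add left_ideal_mult a(2) b(2))
  finally show ?thesis
    using proj_eq[OF a] proj_eq[OF b] proj_eq[OF subalgebra_cl(3)[OF subalgebra_UFK a(1) b(1)]]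
    by (simp add: Uq_simps)
qed

text \<open>The element itself then lies in the left ideal, hence kills \<open>w\<close>.\<close>

lemma proj_zero_central:
  assumes "\<forall>n::nat. n \<ge> 1 \<longrightarrow> q ^ n \<noteq> 1" "\<And>u. x * u \<doteq> u * x"
    and "whittaker_proj q m \<eta> (cl q m x) = cl q m 0"
  shows "x \<doteq> 0"
proof -
  obtain a where a: "cl q m a \<in> UFK" "cl q m (x - a) \<in> left_ideal" using decomposition by metis
  have "a \<in> U_ideal q m" using proj_eq[OF a] assms(3) cl_eq_iff[of q m a 0] by simp
  then have "cl q m (x - a) = cl q m x" using U_ideal_uminus[of a] by (simp add: cl_eq_iff)
  then have "act x (basis 0 0) = (\<lambda>p. 0)" using left_ideal_cl[OF a(2)] act_cl by metis
  moreover have "\<eta> (U_gen q m GenE) \<noteq> 0" using nonsingular by (simp add: nonsingular_character_def)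
  ultimately have "x \<in> U_ideal q m" using assms(1,2) by (intro center_faithful)
  then show ?thesis by (simp add: eqv_def)
qed

lemma center_cl: "cl q m x \<in> algebra_center (Uq q m) \<longleftrightarrow> (\<forall>u. x * u \<doteq> u * x)"
  by (auto simp: algebra_center_def Uq_simps cl_eq_eqv)

theorem center_isomorphism:
  assumes root: "\<forall>n::nat. n \<ge> 1 \<longrightarrow> q ^ n \<noteq> 1"
  shows "subalgebra_of (carrier (W_FK q m \<eta>)) (Uq_FK q m) \<and>
    whittaker_proj q m \<eta> \<in> algebra_iso (ZU q m) (W_FK q m \<eta>)"
proof -
  let ?Z = "algebra_center (Uq q m)" and ?\<pi> = "whittaker_proj q m \<eta>"
  let ?W = "?\<pi> ` ?Z"
  have Z_sub: "subalgebra_of ?Z (Uq q m)" by (rule U.subalgebra_center)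
  note Z = U.subalgebraE[OF Z_sub]
  have Z_rep: "\<exists>x. u = cl q m x \<and> (\<forall>v. x * v \<doteq> v * x)" if "u \<in> ?Z" for u
    using that Z(1) center_cl by (auto simp: Uq_simps)
  have mult: "?\<pi> (u \<otimes>\<^bsub>Uq q m\<^esub> v) = ?\<pi> u \<otimes>\<^bsub>Uq q m\<^esub> ?\<pi> v" if "u \<in> ?Z" "v \<in> ?Z" for u v
    using Z_rep[OF that(1)] Z_rep[OF that(2)] proj_mult_central by (auto simp: Uq_simps)
  have add: "?\<pi> (u \<oplus>\<^bsub>Uq q m\<^esub> v) = ?\<pi> u \<oplus>\<^bsub>Uq q m\<^esub> ?\<pi> v" if "u \<in> ?Z" "v \<in> ?Z" for u v
    using Z_rep[OF that(1)] Z_rep[OF that(2)] proj_add by (auto simp: Uq_simps)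
  have scale: "?\<pi> (s \<odot>\<^bsub>Uq q m\<^esub> u) = s \<odot>\<^bsub>Uq q m\<^esub> ?\<pi> u" if "u \<in> ?Z" for s u
    using Z_rep[OF that] proj_scale by (auto simp: Uq_simps)
  have one: "?\<pi> \<one>\<^bsub>Uq q m\<^esub> = \<one>\<^bsub>Uq q m\<^esub>" by (simp add: Uq_simps proj_one)
  have UFK: "?\<pi> u \<in> UFK" if "u \<in> ?Z" for u
    using Z_rep[OF that] proj_in_UFK by auto
  have W_UFK: "?W \<subseteq> UFK" using UFK by blast
  have W_sub: "subalgebra_of ?W (Uq q m)"
  proof (rule U.subalgebraI)
    show "?W \<subseteq> carrier (Uq q m)" using W_UFK U.subalgebraE(1)[OF subalgebra_UFK] by blast
    show "\<one>\<^bsub>Uq q m\<^esub> \<in> ?W" using one Z(2) by (metis imageI)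
    fix a b s assume "a \<in> ?W"
    then obtain u where u: "u \<in> ?Z" "a = ?\<pi> u" by blast
    show "s \<odot>\<^bsub>Uq q m\<^esub> a \<in> ?W" unfolding u(2) scale[OF u(1), symmetric] by (intro imageI Z(5) u)
    assume "b \<in> ?W"
    then obtain v where v: "v \<in> ?Z" "b = ?\<pi> v" by blast
    show "a \<oplus>\<^bsub>Uq q m\<^esub> b \<in> ?W" unfolding u(2) v(2) add[OF u(1) v(1), symmetric] by (intro imageI Z(3) u v)
    show "a \<otimes>\<^bsub>Uq q m\<^esub> b \<in> ?W" unfolding u(2) v(2) mult[OF u(1) v(1), symmetric] by (intro imageI Z(4) u v)
  qed
  have inj: "inj_on ?\<pi> ?Z"
  proof (rule inj_onI)
    fix u v assume uv: "u \<in> ?Z" "v \<in> ?Z" "?\<pi> u = ?\<pi> v"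
    obtain x where x: "u = cl q m x" "\<And>w. x * w \<doteq> w * x" using Z_rep[OF uv(1)] by blast
    obtain y where y: "v = cl q m y" "\<And>w. y * w \<doteq> w * y" using Z_rep[OF uv(2)] by blast
    let ?d = "x + scalar (- 1) * y"
    have "u \<oplus>\<^bsub>Uq q m\<^esub> (- 1) \<odot>\<^bsub>Uq q m\<^esub> v \<in> ?Z" by (intro Z(3,5) uv)
    then have "\<And>w. ?d * w \<doteq> w * ?d" by (simp add: x(1) y(1) Uq_simps center_cl)
    moreover have "?\<pi> (cl q m ?d) = cl q m 0"
    proof -
      obtain a where "?\<pi> v = cl q m a"
        using UFK[OF uv(2)] U.subalgebraE(1)[OF subalgebra_UFK] by (auto simp: Uq_simps)
      with uv(3) have "?\<pi> (cl q m ?d) = cl q m (a + scalar (- 1) * a)"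
        by (simp only: proj_add proj_scale x(1) y(1) Uq_simps)
      then show ?thesis by (simp add: single_uminus)
    qed
    ultimately have "?d \<doteq> 0" using proj_zero_central[OF root] by blast
    then show "u = v" by (simp add: x(1) y(1) cl_eq_iff eqv_def single_uminus)
  qed
  have "subalgebra_of ?W (Uq_FK q m)"
    unfolding Uq_FK_eq by (rule U.subalgebra_of_subalgebra[OF subalgebra_UFK W_sub W_UFK])
  moreover have "complex_algebra (ZU q m)"
    unfolding ZU_def by (rule U.complex_algebra_subalgebra[OF Z_sub])
  moreover have "complex_algebra (W_FK q m \<eta>)"
    using U.complex_algebra_subalgebra[OF W_sub] by (simp add: W_FK_def Uq_FK_eq ZU_def)
  moreover have "?\<pi> \<in> algebra_hom (ZU q m) (W_FK q m \<eta>)"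
    unfolding algebra_hom_def
    by (auto intro!: ring_hom_memI simp: ZU_def W_FK_def Uq_FK_eq mult add scale one)
  moreover have "bij_betw ?\<pi> (carrier (ZU q m)) (carrier (W_FK q m \<eta>))"
    using inj by (simp add: bij_betw_def ZU_def W_FK_def)
  ultimately show ?thesis
    by (simp add: algebra_iso_def) (simp add: W_FK_def ZU_def)
qed

end

theorem proposition3p5:
  fixes q :: complex and m :: nat and \<eta> :: "free_alg set \<Rightarrow> complex"
  assumes "q \<noteq> 0"
    and "\<forall>n::nat. n \<ge> 1 \<longrightarrow> q ^ n \<noteq> 1"
    and "m \<ge> 1"
    and "nonsingular_character q m \<eta>"
  shows "subalgebra_of (carrier (W_FK q m \<eta>)) (Uq_FK q m) \<and>
    whittaker_proj q m \<eta> \<in> algebra_iso (ZU q m) (W_FK q m \<eta>)"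
proof -
  interpret nonsingular_whittaker q m \<eta>
    by unfold_locales (use assms in auto)
  show ?thesis by (rule center_isomorphism[OF assms(2)])
qed

end
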